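(* Let $\mu_1,\mu_2\in\mathcal{P}_1(\Theta)$, let $\Phi\in L^0(\Theta,\mathbb{R})$ be such that $e^{-\Phi}$ is Lipschitz on $S:=\operatorname{supp}(\mu_1+\mu_2)$ with respect to $d$, and let $(\mu_i)_\Phi\in\mathcal{P}_1(\Theta)$ for $i=1,2$. (i) It holds that $|Z_{\Phi,\mu_1}-Z_{\Phi,\mu_2}|\leq\Vert e^{-\Phi}\Vert_{\mathrm{Lip}(S,d)}\,\mathrm{W}_1(\mu_1,\mu_2)$. In addition, there exists a $1$-Lipschitz function $f_{\mathrm{opt}}$ on $S$ such that $$\mathrm{W}_1((\mu_1)_\Phi,(\mu_2)_\Phi)=\left|\int f_{\mathrm{opt}}\,\mathrm{d}(\mu_1)_\Phi-\int f_{\mathrm{opt}}\,\mathrm{d}(\mu_2)_\Phi\right|.$$ In (ii) and (iii), $f_{\mathrm{opt}}$ denotes such a function. (ii) If $\Vert f_{\mathrm{opt}}e^{-\Phi}\Vert_{\mathrm{Lip}(S,d)}=0$, then there exists $\lambda\in\mathbb{R}$ such that $f_{\mathrm{opt}}=\lambda e^{\Phi}$ on $S$, and $$\mathrm{W}_1((\mu_1)_\Phi,(\mu_2)_\Phi)=|\lambda|\frac{|Z_{\Phi,\mu_1}-Z_{\Phi,\mu_2}|}{Z_{\Phi,\mu_1}Z_{\Phi,\mu_2}}\leq|\lambda|\frac{\Vert e^{-\Phi}\Vert_{\mathrm{Lip}(S,d)}}{Z_{\Phi,\mu_1}Z_{\Phi,\mu_2}}\mathrm{W}_1(\mu_1,\mu_2).$$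 (iii) If $0<\Vert f_{\mathrm{opt}}e^{-\Phi}\Vert_{\mathrm{Lip}(S,d)}<\infty$, $\operatorname{ess\,inf}_{\mu_i}\Phi=0$ for $i=1,2$, and $R(\mu_1+\mu_2)<\infty$, then $$\mathrm{W}_1((\mu_1)_\Phi,(\mu_2)_\Phi)\leq\frac{1+\Vert e^{-\Phi}\Vert_{\mathrm{Lip}(S,d)}R(\mu_1+\mu_2)}{Z_{\Phi,\mu_1}\vee Z_{\Phi,\mu_2}}\mathrm{W}_1(\mu_1,\mu_2)+\frac{|Z_{\Phi,\mu_1}-Z_{\Phi,\mu_2}|}{Z_{\Phi,\mu_1}\vee Z_{\Phi,\mu_2}}R(\mu_1+\mu_2)$$ $$\leq\left(1+2\Vert e^{-\Phi}\Vert_{\mathrm{Lip}(S,d)}R(\mu_1+\mu_2)\right)\frac{\mathrm{W}_1(\mu_1,\mu_2)}{Z_{\Phi,\mu_1}\vee Z_{\Phi,\mu_2}}.$$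
   Context: $(\Theta,d)$ is a Polish space with metric $d$ and Borel $\sigma$-algebra; $\mathcal{P}(\Theta)$ is the set of Borel probability measures on it. $L^0(\Theta,\mathbb{R})$ is the set of measurable functions $\Theta\to\mathbb{R}$. For $\Phi\in L^0(\Theta,\mathbb{R})$ and $\mu\in\mathcal{P}(\Theta)$: $Z_{\Phi,\mu}:=\int e^{-\Phi}\,\mathrm{d}\mu$; if $0<Z_{\Phi,\mu}<\infty$, then $\mu_\Phi$ is the probability measure with $\frac{\mathrm{d}\mu_\Phi}{\mathrm{d}\mu}=e^{-\Phi}/Z_{\Phi,\mu}$ (a requirement such as $\mu_\Phi\in\mathcal{P}_1(\Theta)$ includes $0<Z_{\Phi,\mu}<\infty$). $\mathcal{P}_1(\Theta)$ is the set of $\mu\in\mathcal{P}(\Theta)$ with $\int d(x_0,x)\,\mu(\mathrm{d}x)<\infty$ for some (equivalently, any) $x_0\in\Theta$. $\mathrm{W}_1(\mu,\nu):=\inf_{\pi\in\Pi(\mu,\nu)}\int d(x,y)\,\mathrm{d}\pi(x,y)$, where $\Pi(\mu,\nu)$ is the set of couplings of $\mu$ and $\nu$. For a measure $\mu$, $\operatorname{supp}\mu$ is its support and $R(\mu):=\operatorname{diam}(\operatorname{supp}\mu)=\sup_{x,y\in\operatorname{supp}\mu}d(x,y)$. For $M\subset\Theta$ and $f$ real-valued on $M$ (or on a superset of $M$), $\Vert f\Vert_{\mathrm{Lip}(M,d)}:=\sup_{x\neq y\in M}\frac{|f(x)-f(y)|}{d(x,y)}\in[0,\infty]$; $f$ is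 Lipschitz on $M$ if this is finite and $1$-Lipschitz if it is at most $1$. $a\vee b:=\max\{a,b\}$. *)

theory Defs
  imports "HOL-Probability.Probability"
begin

text \<open>
  The Polish space with its (complete) metric is a type of class \<^class>\<open>polish_space\<close>, the metric
  being \<^const>\<open>dist\<close>.  Quantities that are a priori valued in \<open>[0,\<infinity>]\<close> are \<^typ>\<open>ennreal\<close>-valued, so
  that no junk value stands for infinity and suprema over the empty set are \<open>0\<close>.
\<close>

definition prob_measures :: "'a::polish_space measure set" where
  "prob_measures = {\<mu>. prob_space \<mu> \<and> sets \<mu> = sets borel}"

definition prob_measures1 :: "'a::polish_space measure set" where
  "prob_measures1 =
     {\<mu> \<in> prob_measures. \<exists>x0. (\<integral>\<^sup>+x. ennreal (dist x0 x) \<partial>\<mu>) < \<infinity>}"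

definition normalizer :: "('a::polish_space \<Rightarrow> real) \<Rightarrow> 'a measure \<Rightarrow> ennreal" where
  "normalizer \<Phi> \<mu> = (\<integral>\<^sup>+x. ennreal (exp (- \<Phi> x)) \<partial>\<mu>)"

text \<open>Meaningful only if the normalizer lies strictly between \<open>0\<close> and \<open>\<infinity>\<close>.\<close>

definition gibbs :: "('a::polish_space \<Rightarrow> real) \<Rightarrow> 'a measure \<Rightarrow> 'a measure" where
  "gibbs \<Phi> \<mu> = density \<mu> (\<lambda>x. ennreal (exp (- \<Phi> x)) / normalizer \<Phi> \<mu>)"

definition couplings ::
  "'a::polish_space measure \<Rightarrow> 'a measure \<Rightarrow> ('a \<times> 'a) measure set" where
  "couplings \<mu> \<nu> =
     {\<pi>. prob_space \<pi> \<and> sets \<pi> = sets (borel \<Otimes>\<^sub>M borel) \<and>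
         distr \<pi> borel fst = \<mu> \<and> distr \<pi> borel snd = \<nu>}"

definition W1 :: "'a::polish_space measure \<Rightarrow> 'a measure \<Rightarrow> ennreal" where
  "W1 \<mu> \<nu> = (INF \<pi>\<in>couplings \<mu> \<nu>. \<integral>\<^sup>+(x, y). ennreal (dist x y) \<partial>\<pi>)"

definition measure_add :: "'a measure \<Rightarrow> 'a measure \<Rightarrow> 'a measure" where
  "measure_add \<mu> \<nu> = measure_of (space \<mu>) (sets \<mu>) (\<lambda>A. emeasure \<mu> A + emeasure \<nu> A)"

definition msupp :: "'a::topological_space measure \<Rightarrow> 'a set" where
  "msupp \<mu> = {x. \<forall>U. open U \<and> x \<in> U \<longrightarrow> 0 < emeasure \<mu> U}"

text \<open>The library's \<^const>\<open>diameter\<close> is real-valued and hence not suited to unbounded supports.\<close>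

definition supp_diam :: "'a::metric_space measure \<Rightarrow> ennreal" where
  "supp_diam \<mu> = (SUP x\<in>msupp \<mu>. SUP y\<in>msupp \<mu>. ennreal (dist x y))"

definition lip_norm :: "'a::metric_space set \<Rightarrow> ('a \<Rightarrow> real) \<Rightarrow> ennreal" where
  "lip_norm M f =
     (SUP (x, y)\<in>{(x, y). x \<in> M \<and> y \<in> M \<and> x \<noteq> y}. ennreal (\<bar>f x - f y\<bar> / dist x y))"

definition ess_inf :: "'a measure \<Rightarrow> ('a \<Rightarrow> real) \<Rightarrow> ereal" where
  "ess_inf \<mu> f = - esssup \<mu> (\<lambda>x. - ereal (f x))"

text \<open>
  \<open>f\<close> is an optimal potential on \<open>M\<close>; only its values on \<open>M\<close> are relevant.  For a closed set \<open>M\<close> of full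
  measure and \<open>\<nu>\<^sub>1, \<nu>\<^sub>2\<close> with finite first moment, the Lipschitz condition already entails that \<open>f\<close>
  is integrable over \<open>M\<close>, so that the integrals are genuine.
\<close>

definition optimal_potential ::
  "'a::polish_space set \<Rightarrow> 'a measure \<Rightarrow> 'a measure \<Rightarrow> ('a \<Rightarrow> real) \<Rightarrow> bool" where
  "optimal_potential M \<nu>\<^sub>1 \<nu>\<^sub>2 f \<longleftrightarrow>
     lip_norm M f \<le> 1 \<and>
     W1 \<nu>\<^sub>1 \<nu>\<^sub>2 = ennreal \<bar>(LINT x:M|\<nu>\<^sub>1. f x) - (LINT x:M|\<nu>\<^sub>2. f x)\<bar>"

end

theory Submission
  imports Defs "HOL-Complex_Analysis.Great_Picard"
begin

text \<open>
  The existence of \<open>f\<close> is Kantorovich-Rubinstein duality with an optimal potential. For finitely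
  supported measures, duality follows from the optimality conditions of a quadratically penalised
  transport problem. In general, the identity is approximated in both first moments by a map with
  finite range, and an optimal finite coupling of the image measures is lifted back to the original
  measures; a maximising sequence of potentials converges pointwise along a subsequence by
  equicontinuity and separability.

  For the bounds, write \<open>g = exp (- \<Phi>)\<close> and let \<open>\<mu>\<^sub>i\<close> have normalizer \<open>Z\<^sub>i\<close>. The integral of \<open>f\<close> against
  the Gibbs measure of \<open>\<mu>\<^sub>i\<close> is that of \<open>f g\<close> against \<open>\<mu>\<^sub>i\<close>, divided by \<open>Z\<^sub>i\<close>. After subtracting from \<open>f\<close> its
  value at a point of \<open>S\<close>, the function \<open>f g\<close> is bounded by \<open>R g\<close> and Lipschitz with constant \<open>1 + L R\<close>
  on the part of \<open>S\<close> where \<open>g \<le> 1\<close>, which has full measure.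
\<close>

section \<open>Finite transport duality\<close>

text \<open>Tychonoff's theorem. Transport plans are indexed by all pairs of the two types, possibly
  infinitely many, although only finitely many coordinates enter the objective; hence a product
  topology and no finite-dimensional compactness.\<close>

lemma compact_PiE_UNIV:
  fixes K :: "'i \<Rightarrow> 'b::topological_space set"
  assumes "\<And>i. compact (K i)"
  shows "compact (PiE UNIV K)"
proof -
  have "compactin (product_topology (\<lambda>_::'i. euclidean) UNIV) (PiE UNIV K)"
    by (subst compactin_PiE) (auto simp: assms)
  then show ?thesis
    by (simp add: euclidean_product_topology)
qed

lemma box_attains_inf:
  fixes J :: "('i \<Rightarrow> real) \<Rightarrow> real"
  assumes "0 \<le> P" "continuous_on (PiE UNIV (\<lambda>_. {0..P})) J"
  obtains \<pi> where "\<pi> \<in> PiE UNIV (\<lambda>_. {0..P})" "\<And>\<rho>. \<rho> \<in> PiE UNIV (\<lambda>_. {0..P}) \<Longrightarrow> J \<pi> \<le> J \<rho>"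
proof -
  have "(\<lambda>_. 0) \<in> PiE UNIV (\<lambda>_::'i. {0..P})" using assms by auto
  then have "PiE UNIV (\<lambda>_::'i. {0..P}) \<noteq> {}" by blast
  from continuous_attains_inf[OF compact_PiE_UNIV this assms(2)] that show ?thesis by auto
qed

text \<open>First-order condition at a one-sided minimum: divide by \<open>t\<close> and let it
  decrease to 0.\<close>

lemma nonneg_of_small_quadratic:
  fixes G k s :: real
  assumes "0 < s" and "\<And>t. 0 < t \<Longrightarrow> t \<le> s \<Longrightarrow> 0 \<le> t * G + k * t\<^sup>2"
  shows "0 \<le> G"
proof (rule tendsto_lowerbound)
  show "((\<lambda>t. G + k * t) \<longlongrightarrow> G) (at_right 0)"
    by (auto intro!: tendsto_eq_intros)
  show "\<forall>\<^sub>F t in at_right 0. 0 \<le> G + k * t"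
    unfolding eventually_at_right_field
  proof (intro exI[of _ s] conjI allI impI)
    fix t :: real assume t: "0 < t" "t < s"
    then have "0 \<le> t * (G + k * t)"
      using assms(2)[of t] by (simp add: algebra_simps power2_eq_square)
    then show "0 \<le> G + k * t" using t by (simp add: zero_le_mult_iff)
  qed (use assms in auto)
qed simp

text \<open>
  Minimising the transport cost plus a quadratic penalty on the marginals yields, one coordinate at
  a time, the Karush-Kuhn-Tucker conditions; the multipliers \<open>- k r\<close> and \<open>- k s\<close> of the marginal defects are
  feasible for the dual problem, which bounds the penalised cost.
\<close>

lemma penalized_transport:
  fixes c :: "'a \<Rightarrow> 'b \<Rightarrow> real"
  assumes fin: "finite A" "finite B" and k: "0 < k" and P: "0 < P"
    and c: "\<And>a b. a \<in> A \<Longrightarrow> b \<in> B \<Longrightarrow> 0 \<le> c a b"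
    and p: "\<And>a. a \<in> A \<Longrightarrow> p a < P" and q: "\<And>b. b \<in> B \<Longrightarrow> q b < P"
    and D: "\<And>\<phi> \<psi>. (\<And>a b. a \<in> A \<Longrightarrow> b \<in> B \<Longrightarrow> \<phi> a + \<psi> b \<le> c a b) \<Longrightarrow>
              (\<Sum>a\<in>A. \<phi> a * p a) + (\<Sum>b\<in>B. \<psi> b * q b) \<le> D"
  shows "\<exists>\<pi>\<in>PiE UNIV (\<lambda>_. {0..P}).
     (\<Sum>a\<in>A. \<Sum>b\<in>B. c a b * \<pi> (a, b)) +
     k * ((\<Sum>a\<in>A. ((\<Sum>b\<in>B. \<pi> (a, b)) - p a)\<^sup>2) + (\<Sum>b\<in>B. ((\<Sum>a\<in>A. \<pi> (a, b)) - q b)\<^sup>2)) \<le> D"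
proof -
  define C where "C = (\<lambda>\<pi>. \<Sum>a\<in>A. \<Sum>b\<in>B. c a b * \<pi> (a, b))"
  define r where "r = (\<lambda>\<pi> a. (\<Sum>b\<in>B. \<pi> (a, b)) - p a)"
  define s where "s = (\<lambda>\<pi> b. (\<Sum>a\<in>A. \<pi> (a, b)) - q b)"
  \<comment> \<open>The weight is half that of the claim, so that the derivative of the penalty in a
    marginal defect is \<open>k\<close> times that defect. The full weight reappears when the dual
    value at the multipliers is computed.\<close>
  define J where "J = (\<lambda>\<pi>. C \<pi> + k / 2 * ((\<Sum>a\<in>A. (r \<pi> a)\<^sup>2) + (\<Sum>b\<in>B. (s \<pi> b)\<^sup>2)))"
  let ?X = "PiE UNIV (\<lambda>_::'a \<times> 'b. {0..P})"
  have "continuous_on ?X J"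
    unfolding J_def C_def r_def s_def
    by (intro continuous_intros continuous_on_product_then_coordinatewise)
  with P obtain \<pi> where \<pi>: "\<pi> \<in> ?X" and min: "\<And>\<rho>. \<rho> \<in> ?X \<Longrightarrow> J \<pi> \<le> J \<rho>"
    by (elim box_attains_inf[rotated]) auto
  have \<pi>0: "0 \<le> \<pi> i" and \<pi>P: "\<pi> i \<le> P" for i using \<pi> by auto
  \<comment> \<open>\<open>G a b\<close> is the partial derivative of \<open>J\<close> at the
    minimiser in the coordinate \<open>(a, b)\<close>. Moving this coordinate by \<open>t\<close>
    changes one row defect and one column defect, each contributing
    \<open>k / 2 * t\<^sup>2\<close>.\<close>
  define G where "G = (\<lambda>a b. c a b + k * (r \<pi> a + s \<pi> b))"
  have perturb: "0 \<le> t * G a b + k * t\<^sup>2"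
    if ab: "a \<in> A" "b \<in> B" and t: "0 \<le> \<pi> (a, b) + t" "\<pi> (a, b) + t \<le> P" for a b t
  proof -
    define \<rho> where "\<rho> = \<pi>((a, b) := \<pi> (a, b) + t)"
    have \<rho>_eq: "\<rho> (a', b') = \<pi> (a', b') + (if a' = a then if b' = b then t else 0 else 0)" for a' b'
      by (auto simp: \<rho>_def)
    have "\<rho> \<in> ?X" using \<pi> t by (auto simp: \<rho>_def PiE_iff)
    then have "J \<pi> \<le> J \<rho>" by (rule min)
    have r: "r \<rho> a' = r \<pi> a' + (if a' = a then t else 0)" for a'
      using ab fin by (auto simp: r_def \<rho>_eq sum.distrib)
    have s: "s \<rho> b' = s \<pi> b' + (if b' = b then t else 0)" for b'
      using ab fin by (auto simp: s_def \<rho>_eq sum.distrib)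
    have "C \<rho> = (\<Sum>a'\<in>A. \<Sum>b'\<in>B. c a' b' * \<pi> (a', b') + (if a' = a then if b' = b then c a b * t else 0 else 0))"
      unfolding C_def by (intro sum.cong refl) (auto simp: \<rho>_eq algebra_simps)
    also have "\<dots> = C \<pi> + (\<Sum>a'\<in>A. if a' = a then (\<Sum>b'\<in>B. if b' = b then c a b * t else 0) else 0)"
      unfolding C_def sum.distrib by (intro arg_cong2[where f="(+)"] sum.cong refl) auto
    also have "\<dots> = C \<pi> + c a b * t" using ab fin by simp
    finally have C: "C \<rho> = C \<pi> + c a b * t" .
    have "(\<Sum>a'\<in>A. (r \<rho> a')\<^sup>2) = (\<Sum>a'\<in>A. (r \<pi> a')\<^sup>2 + (if a' = a then 2 * t * r \<pi> a + t\<^sup>2 else 0))"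
      by (intro sum.cong refl) (auto simp: r power2_eq_square algebra_simps)
    then have R: "(\<Sum>a'\<in>A. (r \<rho> a')\<^sup>2) = (\<Sum>a'\<in>A. (r \<pi> a')\<^sup>2) + (2 * t * r \<pi> a + t\<^sup>2)"
      using ab fin by (simp add: sum.distrib)
    have "(\<Sum>b'\<in>B. (s \<rho> b')\<^sup>2) = (\<Sum>b'\<in>B. (s \<pi> b')\<^sup>2 + (if b' = b then 2 * t * s \<pi> b + t\<^sup>2 else 0))"
      by (intro sum.cong refl) (auto simp: s power2_eq_square algebra_simps)
    then have S: "(\<Sum>b'\<in>B. (s \<rho> b')\<^sup>2) = (\<Sum>b'\<in>B. (s \<pi> b')\<^sup>2) + (2 * t * s \<pi> b + t\<^sup>2)"
      using ab fin by (simp add: sum.distrib)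
    have "J \<rho> = J \<pi> + (t * G a b + k * t\<^sup>2)"
      unfolding J_def C R S G_def by (simp add: field_simps)
    with \<open>J \<pi> \<le> J \<rho>\<close> show ?thesis by simp
  qed
  have G_le: "G a b \<le> 0" if "a \<in> A" "b \<in> B" "0 < \<pi> (a, b)" for a b
  proof -
    have "0 \<le> - G a b"
    proof (rule nonneg_of_small_quadratic[of "\<pi> (a, b)" _ k])
      fix t assume "0 < t" "t \<le> \<pi> (a, b)"
      then show "0 \<le> t * - G a b + k * t\<^sup>2"
        using perturb[of a b "- t"] that \<pi>P[of "(a, b)"] by simp
    qed (use that in auto)
    then show ?thesis by simp
  qed
  \<comment> \<open>The upper wall of the box is never active: an entry equal to \<open>P\<close>
    would make both defects positive, hence also the derivative, and lowering the entry would
    decrease \<open>J\<close>.\<close>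
  have less: "\<pi> (a, b) < P" if ab: "a \<in> A" "b \<in> B" for a b
  proof (rule ccontr)
    assume "\<not> \<pi> (a, b) < P"
    then have eq: "\<pi> (a, b) = P" using \<pi>P[of "(a, b)"] by simp
    have "\<pi> (a, b) \<le> (\<Sum>b\<in>B. \<pi> (a, b))" "\<pi> (a, b) \<le> (\<Sum>a\<in>A. \<pi> (a, b))"
      using ab fin \<pi>0 by (auto intro: member_le_sum[where f="\<lambda>b. \<pi> (a, b)"] member_le_sum[where f="\<lambda>a. \<pi> (a, b)"])
    then have "0 < r \<pi> a" "0 < s \<pi> b" using eq p[OF ab(1)] q[OF ab(2)] by (auto simp: r_def s_def)
    then have pos: "0 < G a b" using c[OF ab] k by (simp add: G_def add_nonneg_pos)
    then show False using G_le[OF ab] eq P by simp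
  qed
  have G_ge: "0 \<le> G a b" if ab: "a \<in> A" "b \<in> B" for a b
  proof (rule nonneg_of_small_quadratic[of "P - \<pi> (a, b)" _ k])
    fix t assume "0 < t" "t \<le> P - \<pi> (a, b)"
    then show "0 \<le> t * G a b + k * t\<^sup>2"
      using perturb[of a b t] ab \<pi>0[of "(a, b)"] by simp
  qed (use less[OF ab] in simp)
  \<comment> \<open>Complementary slackness. Summed over all pairs, it turns the dual value at the
    multipliers into the penalised cost.\<close>
  have G0: "G a b * \<pi> (a, b) = 0" if "a \<in> A" "b \<in> B" for a b
    using G_ge[OF that] G_le[OF that] \<pi>0[of "(a, b)"] by (cases "\<pi> (a, b) = 0") auto
  have "(\<Sum>a\<in>A. - k * r \<pi> a * p a) + (\<Sum>b\<in>B. - k * s \<pi> b * q b) \<le> D"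
  proof (rule D)
    fix a b assume "a \<in> A" "b \<in> B"
    then show "- k * r \<pi> a + - k * s \<pi> b \<le> c a b"
      using G_ge[of a b] by (simp add: G_def algebra_simps)
  qed
  moreover have "(\<Sum>a\<in>A. - k * r \<pi> a * p a) + (\<Sum>b\<in>B. - k * s \<pi> b * q b)
      = C \<pi> + k * ((\<Sum>a\<in>A. (r \<pi> a)\<^sup>2) + (\<Sum>b\<in>B. (s \<pi> b)\<^sup>2))"
  proof -
    have *: "p a = (\<Sum>b\<in>B. \<pi> (a, b)) - r \<pi> a" "q b = (\<Sum>a\<in>A. \<pi> (a, b)) - s \<pi> b" for a b
      by (auto simp: r_def s_def)
    have 1: "(\<Sum>a\<in>A. - k * r \<pi> a * p a) = k * (\<Sum>a\<in>A. (r \<pi> a)\<^sup>2) - (\<Sum>a\<in>A. \<Sum>b\<in>B. k * r \<pi> a * \<pi> (a, b))"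
      unfolding *(1) by (simp add: algebra_simps power2_eq_square sum_distrib_left sum_subtractf sum_negf)
    have 2: "(\<Sum>b\<in>B. - k * s \<pi> b * q b) = k * (\<Sum>b\<in>B. (s \<pi> b)\<^sup>2) - (\<Sum>a\<in>A. \<Sum>b\<in>B. k * s \<pi> b * \<pi> (a, b))"
      unfolding *(2) by (subst sum.swap[of _ B A]) (simp add: algebra_simps power2_eq_square sum_distrib_left sum_subtractf sum_negf)
    have "C \<pi> + (\<Sum>a\<in>A. \<Sum>b\<in>B. k * r \<pi> a * \<pi> (a, b)) + (\<Sum>a\<in>A. \<Sum>b\<in>B. k * s \<pi> b * \<pi> (a, b))
        = (\<Sum>a\<in>A. \<Sum>b\<in>B. G a b * \<pi> (a, b))"
      by (simp add: C_def G_def sum.distrib algebra_simps)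
    also have "\<dots> = 0" by (intro sum.neutral ballI G0)
    finally show ?thesis unfolding 1 2 by (simp add: algebra_simps)
  qed
  ultimately show ?thesis
    using \<pi> unfolding C_def r_def s_def by (intro bexI[of _ \<pi>]) auto
qed

text \<open>Strong duality for a finite linear program, with \<open>D\<close> any upper bound of the
  dual values. Plans for growing penalty weights cost at most \<open>D\<close> and have marginal
  defects tending to 0. Instead of extracting a convergent subsequence, one continuous function that
  measures the violation of all requirements is minimised over the box.\<close>

lemma finite_transport_duality:
  fixes c :: "'a \<Rightarrow> 'b \<Rightarrow> real"
  assumes fin: "finite A" "finite B"
    and c: "\<And>a b. a \<in> A \<Longrightarrow> b \<in> B \<Longrightarrow> 0 \<le> c a b"
    and D: "\<And>\<phi> \<psi>. (\<And>a b. a \<in> A \<Longrightarrow> b \<in> B \<Longrightarrow> \<phi> a + \<psi> b \<le> c a b) \<Longrightarrow>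
              (\<Sum>a\<in>A. \<phi> a * p a) + (\<Sum>b\<in>B. \<psi> b * q b) \<le> D"
  obtains \<pi> where "\<And>a b. 0 \<le> \<pi> (a, b)"
    "\<And>a. a \<in> A \<Longrightarrow> (\<Sum>b\<in>B. \<pi> (a, b)) = p a" "\<And>b. b \<in> B \<Longrightarrow> (\<Sum>a\<in>A. \<pi> (a, b)) = q b"
    "(\<Sum>a\<in>A. \<Sum>b\<in>B. c a b * \<pi> (a, b)) \<le> (D::real)"
proof -
  \<comment> \<open>This bound strictly exceeds all prescribed masses and does not depend on the
    penalty weight, so one compact box serves all weights.\<close>
  define P where "P = (\<Sum>a\<in>A. \<bar>p a\<bar>) + (\<Sum>b\<in>B. \<bar>q b\<bar>) + 1"
  have sums: "0 \<le> (\<Sum>a\<in>A. \<bar>p a\<bar>)" "0 \<le> (\<Sum>b\<in>B. \<bar>q b\<bar>)" by (auto intro: sum_nonneg)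
  have p: "p a < P" if "a \<in> A" for a
    using member_le_sum[OF that, of "\<lambda>a. \<bar>p a\<bar>"] fin sums unfolding P_def by linarith
  have q: "q b < P" if "b \<in> B" for b
    using member_le_sum[OF that, of "\<lambda>b. \<bar>q b\<bar>"] fin sums unfolding P_def by linarith
  have P: "0 < P" using sums unfolding P_def by linarith
  let ?X = "PiE UNIV (\<lambda>_::'a \<times> 'b. {0..P})"
  define C where "C = (\<lambda>\<pi>. \<Sum>a\<in>A. \<Sum>b\<in>B. c a b * \<pi> (a, b))"
  define Q where "Q = (\<lambda>\<pi>. (\<Sum>a\<in>A. ((\<Sum>b\<in>B. \<pi> (a, b)) - p a)\<^sup>2) + (\<Sum>b\<in>B. ((\<Sum>a\<in>A. \<pi> (a, b)) - q b)\<^sup>2))"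
  \<comment> \<open>Both summands are nonnegative, so \<open>H\<close> vanishes exactly at plans
    with the right marginals and cost at most \<open>D\<close>.\<close>
  define H where "H = (\<lambda>\<pi>. Q \<pi> + max 0 (C \<pi> - D))"
  have Q_nonneg: "0 \<le> Q \<pi>" for \<pi> by (auto simp: Q_def intro!: add_nonneg_nonneg sum_nonneg)
  have "continuous_on ?X H"
    unfolding H_def Q_def C_def
    by (intro continuous_intros continuous_on_product_then_coordinatewise)
  with P obtain \<pi> where \<pi>: "\<pi> \<in> ?X" and min: "\<And>\<rho>. \<rho> \<in> ?X \<Longrightarrow> H \<pi> \<le> H \<rho>"
    by (elim box_attains_inf[rotated]) auto
  have "H \<pi> \<le> D / real (Suc n)" for n
  proof -
    have "\<exists>\<rho>\<in>?X. C \<rho> + real (Suc n) * Q \<rho> \<le> D"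
      unfolding C_def Q_def by (rule penalized_transport[OF fin _ P c p q D]) auto
    then obtain \<rho> where \<rho>: "\<rho> \<in> ?X" "C \<rho> + real (Suc n) * Q \<rho> \<le> D" by blast
    have "0 \<le> C \<rho>" unfolding C_def using \<rho>(1) c by (intro sum_nonneg mult_nonneg_nonneg) auto
    moreover have "0 \<le> real (Suc n) * Q \<rho>" using Q_nonneg by simp
    ultimately have "C \<rho> \<le> D" "real (Suc n) * Q \<rho> \<le> D" using \<rho>(2) by linarith+
    then have "H \<rho> \<le> D / real (Suc n)" by (simp add: H_def field_simps)
    with min[OF \<rho>(1)] show ?thesis by simp
  qed
  moreover have "(\<lambda>n. D / real (Suc n)) \<longlonglongrightarrow> 0"
    by (rule LIMSEQ_Suc[OF lim_const_over_n])
  ultimately have "H \<pi> \<le> 0" by (meson LIMSEQ_le_const)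
  then have "Q \<pi> = 0" and cost: "C \<pi> \<le> D" using Q_nonneg[of \<pi>] by (auto simp: H_def max_def split: if_splits)
  then have "(\<Sum>a\<in>A. ((\<Sum>b\<in>B. \<pi> (a, b)) - p a)\<^sup>2) = 0" "(\<Sum>b\<in>B. ((\<Sum>a\<in>A. \<pi> (a, b)) - q b)\<^sup>2) = 0"
    unfolding Q_def by (smt (verit) sum_nonneg zero_le_power2)+
  then show ?thesis
    using fin \<pi> cost by (intro that[of \<pi>]) (auto simp: sum_nonneg_eq_0_iff C_def PiE_iff)
qed

section \<open>Couplings\<close>

lemma prob_measuresD:
  assumes "\<mu> \<in> prob_measures"
  shows "prob_space \<mu>" "sets \<mu> = sets borel" "space \<mu> = UNIV"
  using assms sets_eq_imp_space_eq[of \<mu> borel] by (auto simp: prob_measures_def)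

lemma prob_measures1_sub: "\<mu> \<in> prob_measures1 \<Longrightarrow> \<mu> \<in> prob_measures"
  by (simp add: prob_measures1_def)

section \<open>Integration of functions of a map with finite range\<close>

lemma simple_function_comp_measurable:
  assumes "g \<in> N \<rightarrow>\<^sub>M M" "simple_function M f"
  shows "simple_function N (\<lambda>x. f (g x))"
  unfolding simple_function_def
proof safe
  have "(\<lambda>x. f (g x)) ` space N \<subseteq> f ` space M"
    using measurable_space[OF assms(1)] by auto
  then show "finite ((\<lambda>x. f (g x)) ` space N)"
    using assms(2) by (auto simp: simple_function_def intro: finite_subset)
  fix x assume "x \<in> space N"
  then have "f -` {f (g x)} \<inter> space M \<in> sets M"
    using assms measurable_space[OF assms(1)] by (auto simp: simple_function_def)
  from measurable_sets[OF assms(1) this]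
  show "(\<lambda>x. f (g x)) -` {f (g x)} \<inter> space N \<in> sets N"
    by (rule back_subst[where P="\<lambda>X. X \<in> sets N"]) (use measurable_space[OF assms(1)] in auto)
qed

lemma simple_function_borel:
  assumes "simple_function borel T" "sets \<mu> = sets borel"
  shows "simple_function \<mu> T" "finite (range T)" "T -` {a} \<in> sets \<mu>"
proof -
  show "simple_function \<mu> T"
    using assms simple_function_cong_algebra[of \<mu> borel] sets_eq_imp_space_eq[of \<mu> borel] by auto
  show "finite (range T)" using assms(1) by (simp add: simple_function_def)
  show "T -` {a} \<in> sets \<mu>"
  proof (cases "a \<in> range T")
    case False
    then have "T -` {a} = {}" by auto
    then show ?thesis by simp
  qed (use assms in \<open>auto simp: simple_function_def\<close>)
qed

text \<open>The codomain of \<open>T\<close> carries no sigma-algebra: measurability of the finitely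
  many fibres makes \<open>g\<close> after \<open>T\<close> a finite combination of
  indicators.\<close>

lemma nn_integral_simple_comp:
  assumes "simple_function borel T" "sets \<mu> = sets borel"
  shows "(\<integral>\<^sup>+x. g (T x) \<partial>\<mu>) = (\<Sum>a\<in>range T. g a * emeasure \<mu> (T -` {a}))"
proof -
  note T = simple_function_borel[OF assms]
  have "(\<integral>\<^sup>+x. g (T x) \<partial>\<mu>) = (\<integral>\<^sup>+x. (\<Sum>a\<in>range T. g a * indicator (T -` {a}) x) \<partial>\<mu>)"
  proof (rule nn_integral_cong)
    fix x
    have "(\<Sum>a\<in>range T. g a * indicator (T -` {a}) x) = (\<Sum>a\<in>range T. if a = T x then g a else 0)"
      by (intro sum.cong) (auto simp: indicator_def)
    then show "g (T x) = (\<Sum>a\<in>range T. g a * indicator (T -` {a}) x)"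
      using T(2) by simp
  qed
  also have "\<dots> = (\<Sum>a\<in>range T. \<integral>\<^sup>+x. g a * indicator (T -` {a}) x \<partial>\<mu>)"
    by (rule nn_integral_sum) (use T(3) in measurable)
  also have "\<dots> = (\<Sum>a\<in>range T. g a * emeasure \<mu> (T -` {a}))"
    by (simp add: nn_integral_cmult_indicator T(3))
  finally show ?thesis .
qed

lemma lebesgue_integral_simple_comp:
  fixes g :: "_ \<Rightarrow> real"
  assumes "simple_function borel T" "finite_measure \<mu>" "sets \<mu> = sets borel"
  shows "(\<integral>x. g (T x) \<partial>\<mu>) = (\<Sum>a\<in>range T. g a * measure \<mu> (T -` {a}))"
proof -
  interpret finite_measure \<mu> by fact
  note T = simple_function_borel[OF assms(1,3)]
  have "(\<integral>x. g (T x) \<partial>\<mu>) = (\<integral>x. (\<Sum>a\<in>range T. g a * indicator (T -` {a}) x) \<partial>\<mu>)"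
  proof (rule Bochner_Integration.integral_cong[OF refl])
    fix x
    have "(\<Sum>a\<in>range T. g a * indicator (T -` {a}) x) = (\<Sum>a\<in>range T. if a = T x then g a else 0)"
      by (intro sum.cong) (auto simp: indicator_def)
    then show "g (T x) = (\<Sum>a\<in>range T. g a * indicator (T -` {a}) x)"
      using T(2) by simp
  qed
  also have "\<dots> = (\<Sum>a\<in>range T. \<integral>x. g a * indicator (T -` {a}) x \<partial>\<mu>)"
    by (rule Bochner_Integration.integral_sum)
      (auto intro!: integrable_mult_right integrable_real_indicator T(3) simp: less_top[symmetric])
  also have "\<dots> = (\<Sum>a\<in>range T. g a * measure \<mu> (T -` {a}))"
    using sets.sets_into_space[OF T(3)] by (simp add: T(3) Int_absorb2)
  finally show ?thesis .
qed

section \<open>Lifting a finite transport plan to a coupling\<close>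

lemma couplingsD:
  assumes "\<gamma> \<in> couplings \<mu> \<nu>"
  shows "prob_space \<gamma>" "sets \<gamma> = sets (borel \<Otimes>\<^sub>M borel)"
    "distr \<gamma> borel fst = \<mu>" "distr \<gamma> borel snd = \<nu>"
    "fst \<in> \<gamma> \<rightarrow>\<^sub>M borel" "snd \<in> \<gamma> \<rightarrow>\<^sub>M borel"
  using assms by (auto simp: couplings_def cong: measurable_cong_sets)

text \<open>
  As \<open>T\<close> has finite range, the lifted coupling has an explicit density with respect to the product
  measure and no disintegration is needed; the density divides by the masses of the fibres of \<open>T\<close>,
  and fibres of mass zero are taken care of by \<open>x / 0 = 0\<close>.
\<close>

lemma lift_finite_coupling:
  fixes \<mu> \<nu> :: "'a::polish_space measure" and T :: "'a \<Rightarrow> 'b"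
  assumes \<mu>: "\<mu> \<in> prob_measures" and \<nu>: "\<nu> \<in> prob_measures"
    and T: "simple_function borel T"
    and \<pi>: "\<And>a b. 0 \<le> \<pi> (a, b)"
    and p: "\<And>a. a \<in> range T \<Longrightarrow> (\<Sum>b\<in>range T. \<pi> (a, b)) = measure \<mu> (T -` {a})"
    and q: "\<And>b. b \<in> range T \<Longrightarrow> (\<Sum>a\<in>range T. \<pi> (a, b)) = measure \<nu> (T -` {b})"
  obtains \<gamma> where "\<gamma> \<in> couplings \<mu> \<nu>"
    "\<And>k. (\<integral>\<^sup>+z. k (T (fst z)) (T (snd z)) \<partial>\<gamma>) =
      (\<Sum>a\<in>range T. \<Sum>b\<in>range T. k a b * ennreal (\<pi> (a, b)))"
proof -
  note \<mu>' = prob_measuresD[OF \<mu>] and \<nu>' = prob_measuresD[OF \<nu>]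
  note [measurable_cong] = \<mu>'(2) \<nu>'(2)
  interpret \<mu>: prob_space \<mu> by fact
  interpret \<nu>: prob_space \<nu> by fact
  interpret pair_prob_space \<mu> \<nu> ..
  note fin = simple_function_borel(2)[OF T refl]
  let ?F = "range T"
  define p where "p = (\<lambda>a. measure \<mu> (T -` {a}))"
  define q where "q = (\<lambda>b. measure \<nu> (T -` {b}))"
  have pq_nonneg: "0 \<le> p a" "0 \<le> q b" for a b by (auto simp: p_def q_def)
  \<comment> \<open>Nonnegative entries with row or column sum 0 vanish. This makes
    \<open>cancel\<close> hold on fibres of mass zero as well, where the density is 0.\<close>
  have p0: "\<pi> (a, b) = 0" if "p a = 0" "a \<in> ?F" "b \<in> ?F" for a b
    using that assms(5)[of a] \<pi> fin by (auto simp: p_def sum_nonneg_eq_0_iff)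
  have q0: "\<pi> (a, b) = 0" if "q b = 0" "a \<in> ?F" "b \<in> ?F" for a b
    using that assms(6)[of b] \<pi> fin by (auto simp: q_def sum_nonneg_eq_0_iff)
  \<comment> \<open>This density makes the two coordinates independent within each product of
    fibres, where they follow the normalised restrictions of \<mu> and \<nu>, and gives that product
    the mass \<open>\<pi> (a, b)\<close>.\<close>
  define w where "w = (\<lambda>a b. ennreal (\<pi> (a, b) / (p a * q b)))"
  define \<gamma> where "\<gamma> = density (\<mu> \<Otimes>\<^sub>M \<nu>) (\<lambda>z. w (T (fst z)) (T (snd z)))"
  have em: "emeasure \<mu> (T -` {a}) = ennreal (p a)" "emeasure \<nu> (T -` {b}) = ennreal (q b)" for a b
    by (simp_all add: p_def q_def \<mu>.emeasure_eq_measure \<nu>.emeasure_eq_measure)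
  have simple2: "simple_function (\<mu> \<Otimes>\<^sub>M \<nu>) (\<lambda>z. k (T (fst z)) (T (snd z)))" for k :: "'b \<Rightarrow> 'b \<Rightarrow> ennreal"
    by (rule simple_function_compose2[of _ _ _ k])
      (rule simple_function_comp_measurable[OF measurable_fst simple_function_borel(1)[OF T \<mu>'(2)]]
        simple_function_comp_measurable[OF measurable_snd simple_function_borel(1)[OF T \<nu>'(2)]])+
  have meas: "(\<lambda>z. k (T (fst z)) (T (snd z))) \<in> borel_measurable (\<mu> \<Otimes>\<^sub>M \<nu>)"
    for k :: "'b \<Rightarrow> 'b \<Rightarrow> ennreal"
    by (rule borel_measurable_simple_function[OF simple2])
  note [measurable] = meas[of w]
  have \<gamma>_int: "(\<integral>\<^sup>+z. h z \<partial>\<gamma>) = (\<integral>\<^sup>+z. w (T (fst z)) (T (snd z)) * h z \<partial>(\<mu> \<Otimes>\<^sub>M \<nu>))"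
    if "h \<in> borel_measurable (\<mu> \<Otimes>\<^sub>M \<nu>)" for h
    unfolding \<gamma>_def by (rule nn_integral_density[OF meas that])
  have cancel: "w a b * ennreal (q b) * ennreal (p a) = ennreal (\<pi> (a, b))" if "a \<in> ?F" "b \<in> ?F" for a b
    using p0[OF _ that] q0[OF _ that] pq_nonneg(1)[of a] pq_nonneg(2)[of b] \<pi>[of a b]
    by (cases "p a = 0 \<or> q b = 0") (auto simp: w_def ennreal_mult[symmetric])
  have k: "(\<integral>\<^sup>+z. k (T (fst z)) (T (snd z)) \<partial>\<gamma>) = (\<Sum>a\<in>?F. \<Sum>b\<in>?F. k a b * ennreal (\<pi> (a, b)))" for k
  proof -
    have "(\<integral>\<^sup>+z. k (T (fst z)) (T (snd z)) \<partial>\<gamma>)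
        = (\<integral>\<^sup>+x. \<integral>\<^sup>+y. w (T x) (T y) * k (T x) (T y) \<partial>\<nu> \<partial>\<mu>)"
      using \<nu>.nn_integral_fst[OF meas[of "\<lambda>a b. w a b * k a b"]] by (simp add: \<gamma>_int[OF meas])
    also have "\<dots> = (\<Sum>a\<in>?F. (\<Sum>b\<in>?F. w a b * k a b * ennreal (q b)) * ennreal (p a))"
      by (simp add: nn_integral_simple_comp[OF T \<nu>'(2), of "\<lambda>b. w _ b * k _ b"] em
          nn_integral_simple_comp[OF T \<mu>'(2), of "\<lambda>a. \<Sum>b\<in>?F. w a b * k a b * ennreal (q b)"])
    also have "\<dots> = (\<Sum>a\<in>?F. \<Sum>b\<in>?F. k a b * ennreal (\<pi> (a, b)))"
      unfolding sum_distrib_right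
      by (intro sum.cong refl) (simp add: cancel[symmetric] mult_ac)
    finally show ?thesis .
  qed
  \<comment> \<open>Only almost everywhere: on a fibre of mass zero the integral is 0 instead of
    1.\<close>
  have row: "AE x in \<mu>. (\<integral>\<^sup>+y. w (T x) (T y) \<partial>\<nu>) = 1"
  proof -
    have "AE x in \<mu>. \<forall>a\<in>?F. p a = 0 \<longrightarrow> x \<notin> T -` {a}"
    proof (rule AE_finite_allI[OF fin])
      fix a assume "a \<in> ?F"
      show "AE x in \<mu>. p a = 0 \<longrightarrow> x \<notin> T -` {a}"
        using AE_not_in[OF null_setsI[OF _ simple_function_borel(3)[OF T \<mu>'(2), of a]]] em(1)[of a]
        by (cases "p a = 0") auto
    qed
    then show ?thesis
    proof eventually_elim
      case (elim x)
      have nz: "p (T x) \<noteq> 0" using elim by auto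
      have "(\<integral>\<^sup>+y. w (T x) (T y) \<partial>\<nu>) = (\<Sum>b\<in>?F. w (T x) b * ennreal (q b))"
        by (simp add: nn_integral_simple_comp[OF T \<nu>'(2), of "w (T x)"] em)
      also have "\<dots> = (\<Sum>b\<in>?F. ennreal (\<pi> (T x, b) / p (T x)))"
        using q0[of _ "T x"] pq_nonneg \<pi> by (intro sum.cong refl) (auto simp: w_def ennreal_mult'[symmetric])
      also have "\<dots> = ennreal ((\<Sum>b\<in>?F. \<pi> (T x, b)) / p (T x))"
        using pq_nonneg \<pi> by (simp add: sum_divide_distrib)
      finally show ?case using nz assms(5)[of "T x"] by (simp add: p_def)
    qed
  qed
  have col: "AE y in \<nu>. (\<integral>\<^sup>+x. w (T x) (T y) \<partial>\<mu>) = 1"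
  proof -
    have "AE y in \<nu>. \<forall>b\<in>?F. q b = 0 \<longrightarrow> y \<notin> T -` {b}"
    proof (rule AE_finite_allI[OF fin])
      fix b assume "b \<in> ?F"
      show "AE y in \<nu>. q b = 0 \<longrightarrow> y \<notin> T -` {b}"
        using AE_not_in[OF null_setsI[OF _ simple_function_borel(3)[OF T \<nu>'(2), of b]]] em(2)[of b]
        by (cases "q b = 0") auto
    qed
    then show ?thesis
    proof eventually_elim
      case (elim y)
      have nz: "q (T y) \<noteq> 0" using elim by auto
      have "(\<integral>\<^sup>+x. w (T x) (T y) \<partial>\<mu>) = (\<Sum>a\<in>?F. w a (T y) * ennreal (p a))"
        by (simp add: nn_integral_simple_comp[OF T \<mu>'(2), of "\<lambda>a. w a (T y)"] em)
      also have "\<dots> = (\<Sum>a\<in>?F. ennreal (\<pi> (a, T y) / q (T y)))"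
        using p0[of _ "T y"] pq_nonneg \<pi> by (intro sum.cong refl) (auto simp: w_def ennreal_mult'[symmetric])
      also have "\<dots> = ennreal ((\<Sum>a\<in>?F. \<pi> (a, T y)) / q (T y))"
        using pq_nonneg \<pi> by (simp add: sum_divide_distrib)
      finally show ?case using nz assms(6)[of "T y"] by (simp add: q_def)
    qed
  qed
  have sets_\<gamma>: "sets \<gamma> = sets (borel \<Otimes>\<^sub>M borel)"
    unfolding \<gamma>_def by (simp add: sets_pair_measure_cong[OF \<mu>'(2) \<nu>'(2)])
  note [measurable_cong] = sets_\<gamma>
  have marg1: "distr \<gamma> borel fst = \<mu>"
  proof (rule measure_eqI)
    fix X assume "X \<in> sets (distr \<gamma> borel fst)"
    then have X[measurable]: "X \<in> sets borel" by simp
    have ind: "(\<lambda>z. indicator X (fst z) :: ennreal) \<in> borel_measurable (\<mu> \<Otimes>\<^sub>M \<nu>)"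
      by measurable
    have "emeasure (distr \<gamma> borel fst) X = (\<integral>\<^sup>+x. indicator X x \<partial>distr \<gamma> borel fst)"
      by simp
    also have "\<dots> = (\<integral>\<^sup>+z. indicator X (fst z) \<partial>\<gamma>)"
      by (rule nn_integral_distr) measurable
    also have "\<dots> = (\<integral>\<^sup>+x. \<integral>\<^sup>+y. w (T x) (T y) * indicator X x \<partial>\<nu> \<partial>\<mu>)"
      by (simp add: \<gamma>_int[OF ind] \<nu>.nn_integral_fst[OF borel_measurable_times_ennreal[OF meas[of w] ind], symmetric])
    also have "\<dots> = (\<integral>\<^sup>+x. indicator X x \<partial>\<mu>)"
    proof (rule nn_integral_cong_AE, use row in eventually_elim)
      case (elim x)
      then show ?case
        using borel_measurable_simple_function[OF simple_function_compose1[OF simple_function_borel(1)[OF T \<nu>'(2)], of "w (T x)"]]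
        by (simp add: nn_integral_multc)
    qed
    finally show "emeasure (distr \<gamma> borel fst) X = emeasure \<mu> X" using X \<mu>'(2) by simp
  qed (use \<mu>'(2) in simp)
  have marg2: "distr \<gamma> borel snd = \<nu>"
  proof (rule measure_eqI)
    fix X assume "X \<in> sets (distr \<gamma> borel snd)"
    then have X[measurable]: "X \<in> sets borel" by simp
    have ind: "(\<lambda>z. indicator X (snd z) :: ennreal) \<in> borel_measurable (\<mu> \<Otimes>\<^sub>M \<nu>)"
      by measurable
    have "emeasure (distr \<gamma> borel snd) X = (\<integral>\<^sup>+x. indicator X x \<partial>distr \<gamma> borel snd)"
      by simp
    also have "\<dots> = (\<integral>\<^sup>+z. indicator X (snd z) \<partial>\<gamma>)"
      by (rule nn_integral_distr) measurable
    also have "\<dots> = (\<integral>\<^sup>+y. \<integral>\<^sup>+x. w (T x) (T y) * indicator X y \<partial>\<mu> \<partial>\<nu>)"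
      by (simp add: \<gamma>_int[OF ind] nn_integral_snd[OF borel_measurable_times_ennreal[OF meas[of w] ind], symmetric])
    also have "\<dots> = (\<integral>\<^sup>+y. indicator X y \<partial>\<nu>)"
    proof (rule nn_integral_cong_AE, use col in eventually_elim)
      case (elim y)
      then show ?case
        using borel_measurable_simple_function[OF simple_function_compose1[OF simple_function_borel(1)[OF T \<mu>'(2)], of "\<lambda>a. w a (T y)"]]
        by (simp add: nn_integral_multc)
    qed
    finally show "emeasure (distr \<gamma> borel snd) X = emeasure \<nu> X" using X \<nu>'(2) by simp
  qed (use \<nu>'(2) in simp)
  have "prob_space \<gamma>"
    by (rule prob_space_distrD[of fst _ borel]) (auto simp: marg1 \<mu>.prob_space_axioms)
  with sets_\<gamma> marg1 marg2 have "\<gamma> \<in> couplings \<mu> \<nu>" by (simp add: couplings_def)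
  then show ?thesis using k by (rule that)
qed

section \<open>Kantorovich-Rubinstein duality\<close>

lemma prob_measures1_moment:
  assumes "\<mu> \<in> prob_measures1"
  shows "(\<integral>\<^sup>+x. ennreal (dist z x) \<partial>\<mu>) < \<infinity>"
proof -
  obtain x0 where x0: "(\<integral>\<^sup>+x. ennreal (dist x0 x) \<partial>\<mu>) < \<infinity>" and \<mu>: "\<mu> \<in> prob_measures"
    using assms by (auto simp: prob_measures1_def)
  note [measurable_cong] = prob_measuresD(2)[OF \<mu>]
  interpret prob_space \<mu> by (rule prob_measuresD(1)[OF \<mu>])
  have "(\<integral>\<^sup>+x. ennreal (dist z x) \<partial>\<mu>) \<le> (\<integral>\<^sup>+x. ennreal (dist z x0) + ennreal (dist x0 x) \<partial>\<mu>)"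
    by (intro nn_integral_mono) (simp add: ennreal_plus[symmetric] dist_triangle del: ennreal_plus)
  also have "\<dots> = ennreal (dist z x0) + (\<integral>\<^sup>+x. ennreal (dist x0 x) \<partial>\<mu>)"
    by (subst nn_integral_add) (auto simp: emeasure_space_1)
  also have "\<dots> < \<infinity>" using x0 by (simp add: less_top)
  finally show ?thesis .
qed

section \<open>Consequences of finite first moments and the easy half of the duality\<close>

lemma integrable_dist:
  assumes "\<mu> \<in> prob_measures1"
  shows "integrable \<mu> (\<lambda>x. dist z x)"
  using prob_measures1_moment[OF assms, of z]
  by (auto intro!: integrableI_nonneg simp: prob_measuresD(2)[OF prob_measures1_sub[OF assms]] cong: measurable_cong_sets)

lemma integrable_lipschitz:
  fixes f :: "'a::polish_space \<Rightarrow> real"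
  assumes "\<mu> \<in> prob_measures1" "C-lipschitz_on UNIV f"
  shows "integrable \<mu> f"
proof (rule Bochner_Integration.integrable_bound)
  note \<mu> = prob_measuresD[OF prob_measures1_sub[OF assms(1)]]
  interpret prob_space \<mu> by (rule \<mu>(1))
  fix z :: 'a
  show "integrable \<mu> (\<lambda>x. \<bar>f z\<bar> + C * dist z x)"
    using integrable_dist[OF assms(1)] by simp
  show "f \<in> borel_measurable \<mu>"
    using borel_measurable_continuous_onI[OF lipschitz_on_continuous_on[OF assms(2)]] \<mu>(2)
    by (simp cong: measurable_cong_sets)
  show "AE x in \<mu>. norm (f x) \<le> norm (\<bar>f z\<bar> + C * dist z x)"
  proof (rule AE_I2)
    fix x
    have "\<bar>f z - f x\<bar> \<le> C * dist z x"
      using lipschitz_onD[OF assms(2), of z x] by (simp add: dist_real_def)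
    then show "norm (f x) \<le> norm (\<bar>f z\<bar> + C * dist z x)" by simp
  qed
qed

text \<open>The witness is the product measure, obtained by lifting the one-point plan along a
  constant map: its density is then 1.\<close>

lemma couplings_nonempty:
  fixes \<mu> \<nu> :: "'a::polish_space measure"
  assumes "\<mu> \<in> prob_measures" "\<nu> \<in> prob_measures"
  shows "couplings \<mu> \<nu> \<noteq> {}"
proof -
  have *: "measure \<mu> UNIV = 1" "measure \<nu> UNIV = 1"
    using prob_measuresD[OF assms(1)] prob_measuresD[OF assms(2)]
      prob_space.prob_space[of \<mu>] prob_space.prob_space[of \<nu>] by auto
  show ?thesis
  proof (rule lift_finite_coupling[OF assms, of "\<lambda>_. True" "\<lambda>_. 1"])
    show "(\<Sum>b\<in>range (\<lambda>_::'a. True). 1) = measure \<mu> ((\<lambda>_. True) -` {a})"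
      "(\<Sum>b\<in>range (\<lambda>_::'a. True). 1) = measure \<nu> ((\<lambda>_. True) -` {a})"
      if "a \<in> range (\<lambda>_::'a. True)" for a
      using that by (auto simp: *)
  qed (simp, simp, blast)
qed

text \<open>The easy half of duality: integrate the Lipschitz estimate against an arbitrary
  coupling. The estimate is required on a set of full measure only, since the marginals carry full
  measure over to the coupling; this is what allows restriction to the support, or to a smaller
  set.\<close>

lemma integral_diff_le_W1:
  fixes h :: "'a::polish_space \<Rightarrow> real"
  assumes \<mu>: "\<mu> \<in> prob_measures" and \<nu>: "\<nu> \<in> prob_measures"
    and h: "integrable \<mu> h" "integrable \<nu> h"
    and S: "AE x in \<mu>. x \<in> S" "AE x in \<nu>. x \<in> S"
    and lip: "\<And>x y. x \<in> S \<Longrightarrow> y \<in> S \<Longrightarrow> \<bar>h x - h y\<bar> \<le> K * dist x y" and K: "0 \<le> K"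
  shows "ennreal \<bar>(\<integral>x. h x \<partial>\<mu>) - (\<integral>x. h x \<partial>\<nu>)\<bar> \<le> ennreal K * W1 \<mu> \<nu>"
proof -
  let ?d = "ennreal \<bar>(\<integral>x. h x \<partial>\<mu>) - (\<integral>x. h x \<partial>\<nu>)\<bar>"
  have cost: "?d \<le> ennreal K * (\<integral>\<^sup>+(x, y). ennreal (dist x y) \<partial>\<gamma>)" if \<gamma>: "\<gamma> \<in> couplings \<mu> \<nu>" for \<gamma>
  proof -
    note \<gamma>' = couplingsD[OF \<gamma>]
    note [measurable_cong] = \<gamma>'(2)
    have hm: "h \<in> borel_measurable borel"
      using h(1) prob_measuresD(2)[OF \<mu>] by (auto cong: measurable_cong_sets)
    have i1: "integrable \<gamma> (\<lambda>z. h (fst z))" "(\<integral>z. h (fst z) \<partial>\<gamma>) = (\<integral>x. h x \<partial>\<mu>)"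
      using h(1) integrable_distr_eq[OF \<gamma>'(5) hm] integral_distr[OF \<gamma>'(5) hm] by (simp_all add: \<gamma>'(3))
    have i2: "integrable \<gamma> (\<lambda>z. h (snd z))" "(\<integral>z. h (snd z) \<partial>\<gamma>) = (\<integral>x. h x \<partial>\<nu>)"
      using h(2) integrable_distr_eq[OF \<gamma>'(6) hm] integral_distr[OF \<gamma>'(6) hm] by (simp_all add: \<gamma>'(4))
    have "AE z in \<gamma>. fst z \<in> S" by (rule AE_distrD[OF \<gamma>'(5), unfolded \<gamma>'(3), OF S(1)])
    moreover have "AE z in \<gamma>. snd z \<in> S" by (rule AE_distrD[OF \<gamma>'(6), unfolded \<gamma>'(4), OF S(2)])
    ultimately have ae: "AE z in \<gamma>. ennreal \<bar>h (fst z) - h (snd z)\<bar> \<le> ennreal K * ennreal (dist (fst z) (snd z))"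
      by eventually_elim (use K lip in \<open>auto simp: ennreal_mult[symmetric]\<close>)
    have "?d = ennreal (norm (\<integral>z. h (fst z) - h (snd z) \<partial>\<gamma>))"
      using i1 i2 by simp
    also have "\<dots> \<le> (\<integral>\<^sup>+z. ennreal \<bar>h (fst z) - h (snd z)\<bar> \<partial>\<gamma>)"
      using integral_norm_bound_ennreal[OF Bochner_Integration.integrable_diff[OF i1(1) i2(1)]] by simp
    also have "\<dots> \<le> (\<integral>\<^sup>+z. ennreal K * ennreal (dist (fst z) (snd z)) \<partial>\<gamma>)"
      by (rule nn_integral_mono_AE[OF ae])
    also have "\<dots> = ennreal K * (\<integral>\<^sup>+z. ennreal (dist (fst z) (snd z)) \<partial>\<gamma>)"
      by (rule nn_integral_cmult) measurable
    finally show ?thesis by (simp add: case_prod_unfold)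
  qed
  \<comment> \<open>A positive \<open>K\<close> is moved out of the infimum by multiplying with
    \<open>1 / K\<close>. For \<open>K = 0\<close> a single coupling already shows that the
    difference vanishes.\<close>
  show ?thesis
  proof (cases "K = 0")
    case True
    with cost couplings_nonempty[OF \<mu> \<nu>] show ?thesis by force
  next
    case False
    have "ennreal (1 / K) * ?d \<le> W1 \<mu> \<nu>"
      unfolding W1_def
    proof (rule INF_greatest)
      fix \<gamma> assume \<gamma>: "\<gamma> \<in> couplings \<mu> \<nu>"
      have "ennreal (1 / K) * ?d \<le> ennreal (1 / K) * (ennreal K * (\<integral>\<^sup>+(x, y). ennreal (dist x y) \<partial>\<gamma>))"
        by (rule mult_left_mono[OF cost[OF \<gamma>]]) simp
      also have "\<dots> = (\<integral>\<^sup>+(x, y). ennreal (dist x y) \<partial>\<gamma>)"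
        using K False by (simp add: mult.assoc[symmetric] ennreal_mult[symmetric])
      finally show "ennreal (1 / K) * ?d \<le> (\<integral>\<^sup>+(x, y). ennreal (dist x y) \<partial>\<gamma>)" .
    qed
    then have "ennreal K * (ennreal (1 / K) * ?d) \<le> ennreal K * W1 \<mu> \<nu>"
      by (rule mult_left_mono) simp
    then show ?thesis
      using K False by (simp add: mult.assoc[symmetric] ennreal_mult[symmetric])
  qed
qed

text \<open>The identity is a pointwise limit of simple maps whose distance to a base point
  \<open>z\<close> is at most doubled. The displacement is thus at most \<open>3 * dist z x\<close>,
  and dominated convergence applies; one index serves both measures.\<close>

lemma finite_range_approximation:
  fixes \<mu> \<nu> :: "'a::polish_space measure"
  assumes "\<mu> \<in> prob_measures1" "\<nu> \<in> prob_measures1" "0 < \<epsilon>"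
  obtains T :: "'a \<Rightarrow> 'a" where "simple_function borel T"
    "(\<integral>\<^sup>+x. ennreal (dist x (T x)) \<partial>\<mu>) \<le> ennreal \<epsilon>" "(\<integral>\<^sup>+x. ennreal (dist x (T x)) \<partial>\<nu>) \<le> ennreal \<epsilon>"
proof -
  obtain z :: 'a where True by simp
  have "\<exists>F. (\<forall>i. simple_function borel (F i)) \<and> (\<forall>x\<in>space borel. (\<lambda>i. F i x) \<longlonglongrightarrow> (\<lambda>x::'a. x) x) \<and>
    (\<forall>i. \<forall>x\<in>space borel. dist (F i x) z \<le> 2 * dist x z)"
    by (rule borel_measurable_implies_sequence_metric) simp
  then obtain F :: "nat \<Rightarrow> 'a \<Rightarrow> 'a" where F: "\<And>i. simple_function borel (F i)"
      "\<And>x. (\<lambda>i. F i x) \<longlonglongrightarrow> x" "\<And>i x. dist (F i x) z \<le> 2 * dist x z"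
    by auto
  have small: "\<forall>\<^sub>F i in sequentially. (\<integral>\<^sup>+x. ennreal (dist x (F i x)) \<partial>\<rho>) < ennreal \<epsilon>"
    if \<rho>: "\<rho> \<in> prob_measures1" for \<rho>
  proof -
    note [measurable_cong] = prob_measuresD(2)[OF prob_measures1_sub[OF \<rho>]]
    note [measurable] = borel_measurable_simple_function[OF F(1)]
    have "(\<lambda>i. \<integral>\<^sup>+x. ennreal (dist x (F i x)) \<partial>\<rho>) \<longlonglongrightarrow> (\<integral>\<^sup>+x. 0 \<partial>\<rho>)"
    proof (rule nn_integral_dominated_convergence[where w="\<lambda>x. ennreal 3 * ennreal (dist z x)"])
      fix i
      have "dist x (F i x) \<le> 3 * dist z x" for x
        using F(3)[of i x] dist_triangle2[of x "F i x" z] by (simp add: dist_commute)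
      then show "AE x in \<rho>. ennreal (dist x (F i x)) \<le> ennreal 3 * ennreal (dist z x)"
        by (intro AE_I2) (simp add: ennreal_mult[symmetric] del: ennreal_numeral)
    next
      show "(\<integral>\<^sup>+x. ennreal 3 * ennreal (dist z x) \<partial>\<rho>) < \<infinity>"
        using prob_measures1_moment[OF \<rho>, of z]
        by (subst nn_integral_cmult) (auto simp: ennreal_mult_less_top simp del: ennreal_numeral)
      have "(\<lambda>i. dist x (F i x)) \<longlonglongrightarrow> dist x x" for x
        by (intro tendsto_intros F)
      then show "AE x in \<rho>. (\<lambda>i. ennreal (dist x (F i x))) \<longlonglongrightarrow> 0"
        using tendsto_ennrealI by (intro AE_I2) fastforce
    qed measurable
    then show ?thesis
      using assms(3) by (auto dest!: order_tendstoD(2)[where a="ennreal \<epsilon>"])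
  qed
  from eventually_happens'[OF sequentially_bot eventually_conj[OF small[OF assms(1)] small[OF assms(2)]]]
  show ?thesis using F(1) that by (auto intro: less_imp_le)
qed

text \<open>The hard half of duality. The problem is pushed to the finite range of \<open>T\<close>,
  solved there, and its plan is lifted to a coupling of the original measures.\<close>

lemma W1_le_if_dual_le:
  fixes \<mu> \<nu> :: "'a::polish_space measure"
  assumes \<mu>: "\<mu> \<in> prob_measures1" and \<nu>: "\<nu> \<in> prob_measures1"
    and D: "\<And>f. 1-lipschitz_on UNIV f \<Longrightarrow> (\<integral>x. f x \<partial>\<mu>) - (\<integral>x. f x \<partial>\<nu>) \<le> D"
  shows "W1 \<mu> \<nu> \<le> ennreal D"
proof (rule ennreal_le_epsilon)
  fix e :: real assume e: "0 < e"
  \<comment> \<open>Testing with the zero function ensures that \<open>ennreal\<close> does not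
    truncate \<open>D\<close>.\<close>
  have D0: "0 \<le> D" using D[of "\<lambda>_. 0"] by (simp add: lipschitz_on_def)
  \<comment> \<open>Replacing \<open>x\<close> by \<open>T x\<close> costs \<epsilon> four times:
    for each measure once in the dual value and once in the transport cost.\<close>
  define \<epsilon> where "\<epsilon> = e / 4"
  have \<epsilon>: "0 < \<epsilon>" using e by (simp add: \<epsilon>_def)
  note \<mu>0 = prob_measures1_sub[OF \<mu>] and \<nu>0 = prob_measures1_sub[OF \<nu>]
  note \<mu>' = prob_measuresD[OF \<mu>0] and \<nu>' = prob_measuresD[OF \<nu>0]
  interpret \<mu>: prob_space \<mu> by fact
  interpret \<nu>: prob_space \<nu> by fact
  obtain T :: "'a \<Rightarrow> 'a" where T: "simple_function borel T"
    and T\<mu>: "(\<integral>\<^sup>+x. ennreal (dist x (T x)) \<partial>\<mu>) \<le> ennreal \<epsilon>" 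
    and T\<nu>: "(\<integral>\<^sup>+x. ennreal (dist x (T x)) \<partial>\<nu>) \<le> ennreal \<epsilon>"
    by (rule finite_range_approximation[OF \<mu> \<nu> \<epsilon>])
  let ?F = "range T"
  have fin: "finite ?F" using T by (simp add: simple_function_def)
  have T_meas[measurable]: "T \<in> borel_measurable borel" by (rule borel_measurable_simple_function[OF T])
  have close: "\<bar>(\<integral>x. f (T x) \<partial>\<rho>) - (\<integral>x. f x \<partial>\<rho>)\<bar> \<le> \<epsilon>"
    if \<rho>: "\<rho> \<in> prob_measures1" and small: "(\<integral>\<^sup>+x. ennreal (dist x (T x)) \<partial>\<rho>) \<le> ennreal \<epsilon>"
      and f: "1-lipschitz_on UNIV f" for \<rho> and f :: "'a \<Rightarrow> real"
  proof -
    note \<rho>' = prob_measuresD[OF prob_measures1_sub[OF \<rho>]]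
    interpret prob_space \<rho> by fact
    note [measurable_cong] = \<rho>'(2)
    have fm: "f \<in> borel_measurable borel"
      by (rule borel_measurable_continuous_onI[OF lipschitz_on_continuous_on[OF f]])
    have "integrable \<rho> (\<lambda>x. f (T x))"
    proof (rule integrable_const_bound[where B="Max ((\<lambda>a. \<bar>f a\<bar>) ` ?F)"])
      show "AE x in \<rho>. norm (f (T x)) \<le> Max ((\<lambda>a. \<bar>f a\<bar>) ` ?F)"
        using fin by (auto intro!: AE_I2 Max_ge)
      show "(\<lambda>x. f (T x)) \<in> borel_measurable \<rho>" using fm by measurable
    qed
    then have int: "integrable \<rho> (\<lambda>x. f (T x) - f x)" 
      and eq: "(\<integral>x. f (T x) - f x \<partial>\<rho>) = (\<integral>x. f (T x) \<partial>\<rho>) - (\<integral>x. f x \<partial>\<rho>)"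
      using integrable_lipschitz[OF \<rho> f] by auto
    have "ennreal \<bar>(\<integral>x. f (T x) \<partial>\<rho>) - (\<integral>x. f x \<partial>\<rho>)\<bar> \<le> (\<integral>\<^sup>+x. ennreal (norm (f (T x) - f x)) \<partial>\<rho>)"
      using integral_norm_bound_ennreal[OF int] by (simp add: eq)
    also have "\<dots> \<le> (\<integral>\<^sup>+x. ennreal (dist x (T x)) \<partial>\<rho>)"
      using lipschitz_onD[OF f, of "T _"]
      by (intro nn_integral_mono ennreal_leI) (simp add: dist_real_def[symmetric] dist_commute)
    also note small
    finally show ?thesis using \<epsilon> by simp
  qed
  define p where "p = (\<lambda>a. measure \<mu> (T -` {a}))"
  define q where "q = (\<lambda>a. measure \<nu> (T -` {a}))"
  obtain \<pi> where \<pi>: "\<And>a b. 0 \<le> \<pi> (a, b)"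
    "\<And>a. a \<in> ?F \<Longrightarrow> (\<Sum>b\<in>?F. \<pi> (a, b)) = p a" "\<And>b. b \<in> ?F \<Longrightarrow> (\<Sum>a\<in>?F. \<pi> (a, b)) = q b"
    and cost: "(\<Sum>a\<in>?F. \<Sum>b\<in>?F. dist a b * \<pi> (a, b)) \<le> D + 2 * \<epsilon>"
  proof (rule finite_transport_duality[OF fin fin, where c=dist and p=p and q=q and D="D + 2 * \<epsilon>"])
    fix \<phi> \<psi> :: "'a \<Rightarrow> real"
    assume feas: "\<And>a b. a \<in> ?F \<Longrightarrow> b \<in> ?F \<Longrightarrow> \<phi> a + \<psi> b \<le> dist a b"
    \<comment> \<open>The c-transform of \<psi>: a minimum of 1-Lipschitz functions, hence
      1-Lipschitz. Feasibility places it above \<phi> on the range, and taking \<open>x = b\<close>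
      places \<psi> below its negative, so the pair \<open>f\<close>, \<open>- f\<close> has at
      least the dual value of the given pair.\<close>
    define f where "f = (\<lambda>x. Min ((\<lambda>b. dist x b - \<psi> b) ` ?F))"
    have f_le: "f x \<le> dist x b - \<psi> b" if "b \<in> ?F" for x b
      unfolding f_def using fin that by (intro Min_le) auto
    have f_ge: "t \<le> f x" if "\<And>b. b \<in> ?F \<Longrightarrow> t \<le> dist x b - \<psi> b" for t x
      unfolding f_def using fin that by (subst Min_ge_iff) auto
    have step: "f x \<le> f y + dist x y" for x y
    proof -
      have "f x - dist x y \<le> f y"
      proof (rule f_ge)
        fix b assume "b \<in> ?F"
        from f_le[OF this, of x] dist_triangle[of x b y] show "f x - dist x y \<le> dist y b - \<psi> b" by simp
      qed
      then show ?thesis by simp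
    qed
    have f: "1-lipschitz_on UNIV f"
    proof (rule lipschitz_onI)
      fix x y show "dist (f x) (f y) \<le> 1 * dist x y"
        using step[of x y] step[of y x] by (simp add: dist_real_def dist_commute)
    qed simp
    have "(\<Sum>a\<in>?F. \<phi> a * p a) \<le> (\<Sum>a\<in>?F. f a * p a)"
      using feas by (intro sum_mono mult_right_mono f_ge) (auto simp: p_def algebra_simps)
    also have "\<dots> = (\<integral>x. f (T x) \<partial>\<mu>)"
      by (simp add: lebesgue_integral_simple_comp[OF T \<mu>.finite_measure_axioms \<mu>'(2)] p_def)
    finally have 1: "(\<Sum>a\<in>?F. \<phi> a * p a) \<le> (\<integral>x. f (T x) \<partial>\<mu>)" .
    have "(\<Sum>b\<in>?F. \<psi> b * q b) \<le> (\<Sum>b\<in>?F. - (f b * q b))"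
    proof (rule sum_mono)
      fix b assume "b \<in> ?F"
      then have "\<psi> b \<le> - f b" using f_le[of b b] by simp
      then have "\<psi> b * q b \<le> - f b * q b" by (rule mult_right_mono) (simp add: q_def)
      then show "\<psi> b * q b \<le> - (f b * q b)" by simp
    qed
    also have "\<dots> = - (\<integral>x. f (T x) \<partial>\<nu>)"
      by (simp add: lebesgue_integral_simple_comp[OF T \<nu>.finite_measure_axioms \<nu>'(2)] q_def sum_negf)
    finally have 2: "(\<Sum>b\<in>?F. \<psi> b * q b) \<le> - (\<integral>x. f (T x) \<partial>\<nu>)" .
    show "(\<Sum>a\<in>?F. \<phi> a * p a) + (\<Sum>b\<in>?F. \<psi> b * q b) \<le> D + 2 * \<epsilon>"
      using 1 2 close[OF \<mu> T\<mu> f] close[OF \<nu> T\<nu> f] D[OF f] by linarith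
  qed (use that in auto)
  obtain \<gamma> where \<gamma>: "\<gamma> \<in> couplings \<mu> \<nu>" and lift: "\<And>k. (\<integral>\<^sup>+z. k (T (fst z)) (T (snd z)) \<partial>\<gamma>) =
      (\<Sum>a\<in>?F. \<Sum>b\<in>?F. k a b * ennreal (\<pi> (a, b)))"
    using lift_finite_coupling[OF \<mu>0 \<nu>0 T \<pi>(1) \<pi>(2)[unfolded p_def] \<pi>(3)[unfolded q_def]] by blast
  note \<gamma>' = couplingsD[OF \<gamma>]
  note [measurable_cong] = \<gamma>'(2)
  \<comment> \<open>Travel from \<open>x\<close> through \<open>T x\<close> and \<open>T y\<close>
    to \<open>y\<close>. The outer distances depend on one marginal each; the middle one is the cost
    of the finite plan.\<close>
  have "W1 \<mu> \<nu> \<le> (\<integral>\<^sup>+(x, y). ennreal (dist x y) \<partial>\<gamma>)"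
    unfolding W1_def by (rule INF_lower[OF \<gamma>])
  also have "\<dots> \<le> (\<integral>\<^sup>+z. (ennreal (dist (fst z) (T (fst z))) + ennreal (dist (T (fst z)) (T (snd z))))
      + ennreal (dist (snd z) (T (snd z))) \<partial>\<gamma>)"
  proof (rule nn_integral_mono)
    fix z :: "'a \<times> 'a"
    have "dist (fst z) (snd z) \<le> dist (fst z) (T (fst z)) + dist (T (fst z)) (T (snd z)) + dist (snd z) (T (snd z))"
      using dist_triangle[of "fst z" "snd z" "T (fst z)"] dist_triangle[of "T (fst z)" "snd z" "T (snd z)"]
      by (simp add: dist_commute)
    then show "(case z of (x, y) \<Rightarrow> ennreal (dist x y)) \<le> ennreal (dist (fst z) (T (fst z)))
        + ennreal (dist (T (fst z)) (T (snd z))) + ennreal (dist (snd z) (T (snd z)))"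
      by (simp add: case_prod_beta ennreal_plus[symmetric] del: ennreal_plus)
  qed
  also have "\<dots> = ((\<integral>\<^sup>+z. ennreal (dist (fst z) (T (fst z))) \<partial>\<gamma>)
      + (\<integral>\<^sup>+z. ennreal (dist (T (fst z)) (T (snd z))) \<partial>\<gamma>)) + (\<integral>\<^sup>+z. ennreal (dist (snd z) (T (snd z))) \<partial>\<gamma>)"
    by (subst nn_integral_add, measurable)+
  also have "(\<integral>\<^sup>+z. ennreal (dist (fst z) (T (fst z))) \<partial>\<gamma>) = (\<integral>\<^sup>+x. ennreal (dist x (T x)) \<partial>\<mu>)"
    unfolding \<gamma>'(3)[symmetric] by (rule nn_integral_distr[symmetric]) measurable
  also have "(\<integral>\<^sup>+z. ennreal (dist (snd z) (T (snd z))) \<partial>\<gamma>) = (\<integral>\<^sup>+x. ennreal (dist x (T x)) \<partial>\<nu>)"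
    unfolding \<gamma>'(4)[symmetric] by (rule nn_integral_distr[symmetric]) measurable
  also have "(\<integral>\<^sup>+z. ennreal (dist (T (fst z)) (T (snd z))) \<partial>\<gamma>)
      = ennreal (\<Sum>a\<in>?F. \<Sum>b\<in>?F. dist a b * \<pi> (a, b))"
    using \<pi>(1) by (simp add: lift[of "\<lambda>a b. ennreal (dist a b)"] ennreal_mult[symmetric] sum_nonneg)
  also have "(\<integral>\<^sup>+x. ennreal (dist x (T x)) \<partial>\<mu>) + ennreal (\<Sum>a\<in>?F. \<Sum>b\<in>?F. dist a b * \<pi> (a, b))
      + (\<integral>\<^sup>+x. ennreal (dist x (T x)) \<partial>\<nu>) \<le> ennreal \<epsilon> + ennreal (D + 2 * \<epsilon>) + ennreal \<epsilon>"
    by (intro add_mono T\<mu> T\<nu> ennreal_leI cost)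
  also have "\<dots> = ennreal D + ennreal e"
    using D0 \<epsilon> by (simp add: ennreal_plus[symmetric] \<epsilon>_def del: ennreal_plus)
  finally show "W1 \<mu> \<nu> \<le> ennreal D + ennreal e" .
qed

text \<open>A pointwise form of Arzela-Ascoli: a diagonal sequence converges on a countable dense
  set, and the common Lipschitz constant makes it Cauchy at every other point.\<close>

lemma lipschitz_convergent_subsequence:
  fixes f :: "nat \<Rightarrow> 'a::{metric_space, second_countable_topology} \<Rightarrow> real"
  assumes lip: "\<And>n. C-lipschitz_on UNIV (f n)" and bound: "\<And>n x. \<bar>f n x\<bar> \<le> B x"
  obtains k g where "strict_mono k" "\<And>x. (\<lambda>n. f (k n) x) \<longlonglongrightarrow> g x"
proof -
  obtain D :: "'a set" where D: "countable D" "\<And>X. open X \<Longrightarrow> X \<noteq> {} \<Longrightarrow> \<exists>d\<in>D. d \<in> X"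
    by (erule countable_dense_setE)
  have C0: "0 \<le> C" by (rule lipschitz_on_nonneg[OF lip])
  have B0: "0 \<le> B x" for x using bound[of 0 x] by simp
  \<comment> \<open>The diagonal argument is applied under a bound uniform in \<open>x\<close>;
    rescaling by \<open>1 + B x\<close>, which is positive, provides it and can be undone
    pointwise.\<close>
  have "norm (f n x / (1 + B x)) \<le> 1" for n x using bound[of n x] B0[of x] by simp
  then obtain k :: "nat \<Rightarrow> nat" where k: "strict_mono k"
      "\<And>x. x \<in> D \<Longrightarrow> \<exists>l. (\<lambda>n. f (k n) x / (1 + B x)) \<longlonglongrightarrow> l"
    using function_convergent_subsequence[OF D(1), of "\<lambda>n x. f n x / (1 + B x)" 1] by blast
  have conv_D: "Cauchy (\<lambda>n. f (k n) d)" if d: "d \<in> D" for d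
  proof -
    obtain l where "(\<lambda>n. f (k n) d / (1 + B d)) \<longlonglongrightarrow> l" using k(2)[OF d] by blast
    then have "(\<lambda>n. (1 + B d) * (f (k n) d / (1 + B d))) \<longlonglongrightarrow> (1 + B d) * l"
      by (rule tendsto_mult_left)
    then show ?thesis using B0[of d] by (intro LIMSEQ_imp_Cauchy) simp
  qed
  have "Cauchy (\<lambda>n. f (k n) x)" for x
  proof (rule metric_CauchyI)
    fix e :: real assume e: "0 < e"
    \<comment> \<open>The summand 1 keeps the denominator positive when
      \<open>C = 0\<close>.\<close>
    define r where "r = e / (3 * (C + 1))"
    have r: "0 < r" "C * r \<le> e / 3" using e C0 by (auto simp: r_def field_simps)
    obtain d where d: "d \<in> D" "dist x d < r" using D(2)[of "ball x r"] r(1) by auto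
    have near: "\<bar>f n x - f n d\<bar> \<le> e / 3" for n
      using lipschitz_onD[OF lip, of x d n] mult_left_mono[OF less_imp_le[OF d(2)] C0] r(2)
      by (simp add: dist_real_def)
    obtain M where M: "\<And>m n. m \<ge> M \<Longrightarrow> n \<ge> M \<Longrightarrow> dist (f (k m) d) (f (k n) d) < e / 3"
      using metric_CauchyD[OF conv_D[OF d(1)], of "e / 3"] e by auto
    have "dist (f (k m) x) (f (k n) x) < e" if "m \<ge> M" "n \<ge> M" for m n
      using M[OF that] near[of "k m"] near[of "k n"] unfolding dist_real_def by linarith
    then show "\<exists>M. \<forall>m\<ge>M. \<forall>n\<ge>M. dist (f (k m) x) (f (k n) x) < e" by blast
  qed
  then have "convergent (\<lambda>n. f (k n) x)" for x by (simp add: Cauchy_convergent_iff)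
  then have "(\<lambda>n. f (k n) x) \<longlonglongrightarrow> lim (\<lambda>n. f (k n) x)" for x by (simp add: convergent_LIMSEQ_iff)
  with k(1) show ?thesis by (rule that)
qed

text \<open>A maximising sequence of potentials, shifted to vanish at \<open>z\<close>, is dominated
  by \<open>dist z\<close>. A pointwise limit along a subsequence attains the supremum by dominated
  convergence, and the two halves of the duality identify its value with the transport
  distance.\<close>

theorem kantorovich_rubinstein:
  fixes \<mu> \<nu> :: "'a::polish_space measure"
  assumes \<mu>: "\<mu> \<in> prob_measures1" and \<nu>: "\<nu> \<in> prob_measures1"
  obtains f where "1-lipschitz_on UNIV f" "W1 \<mu> \<nu> = ennreal ((\<integral>x. f x \<partial>\<mu>) - (\<integral>x. f x \<partial>\<nu>))"
proof -
  interpret \<mu>: prob_space \<mu> by (rule prob_measuresD(1)[OF prob_measures1_sub[OF \<mu>]])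
  interpret \<nu>: prob_space \<nu> by (rule prob_measuresD(1)[OF prob_measures1_sub[OF \<nu>]])
  obtain z :: 'a where True by simp
  define v where "v = (\<lambda>f::'a \<Rightarrow> real. (\<integral>x. f x \<partial>\<mu>) - (\<integral>x. f x \<partial>\<nu>))"
  define V where "V = v ` {f. 1-lipschitz_on UNIV f}"
  have int: "integrable \<mu> f" "integrable \<nu> f" if "1-lipschitz_on UNIV f" for f :: "'a \<Rightarrow> real"
    using integrable_lipschitz[OF \<mu> that] integrable_lipschitz[OF \<nu> that] by auto
  \<comment> \<open>Both measures have total mass 1, so subtracting a constant leaves the dual value
    unchanged.\<close>
  have normalize: "1-lipschitz_on UNIV (\<lambda>x. f x - f z)" "v (\<lambda>x. f x - f z) = v f"
    "\<bar>f x - f z\<bar> \<le> dist z x" if f: "1-lipschitz_on UNIV f" for f :: "'a \<Rightarrow> real" and x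
  proof -
    show "1-lipschitz_on UNIV (\<lambda>x. f x - f z)" using f by (simp add: lipschitz_on_def dist_real_def)
    show "v (\<lambda>x. f x - f z) = v f" using int[OF f] by (simp add: v_def \<mu>.prob_space \<nu>.prob_space)
    show "\<bar>f x - f z\<bar> \<le> dist z x"
      using lipschitz_onD[OF f, of x z] by (simp add: dist_real_def dist_commute)
  qed
  have v_le: "v f \<le> (\<integral>x. dist z x \<partial>\<mu>) + (\<integral>x. dist z x \<partial>\<nu>)" if f: "1-lipschitz_on UNIV f" for f :: "'a \<Rightarrow> real"
  proof -
    let ?f = "\<lambda>x. f x - f z"
    have "(\<integral>x. ?f x \<partial>\<mu>) \<le> (\<integral>x. dist z x \<partial>\<mu>)"
      using normalize(3)[OF f] int[OF normalize(1)[OF f]] by (intro integral_mono integrable_dist \<mu>) (auto simp: abs_le_iff)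
    moreover have "(\<integral>x. - ?f x \<partial>\<nu>) \<le> (\<integral>x. dist z x \<partial>\<nu>)"
      using normalize(3)[OF f] int[OF normalize(1)[OF f]]
      by (intro integral_mono integrable_dist \<nu> Bochner_Integration.integrable_minus) (auto simp: abs_le_iff)
    ultimately have "v ?f \<le> (\<integral>x. dist z x \<partial>\<mu>) + (\<integral>x. dist z x \<partial>\<nu>)"
      unfolding v_def integral_minus by linarith
    then show ?thesis by (simp add: normalize(2)[OF f])
  qed
  have bdd: "bdd_above V" using v_le by (auto simp: V_def intro!: bdd_aboveI)
  have ne: "V \<noteq> {}" by (auto simp: V_def lipschitz_on_def intro!: exI[of _ "\<lambda>_. 0"])
  have upper: "v f \<le> Sup V" if "1-lipschitz_on UNIV f" for f
    by (rule cSup_upper[OF _ bdd]) (use that in \<open>auto simp: V_def\<close>)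
  have "\<exists>f. 1-lipschitz_on UNIV f \<and> Sup V - 1 / real (Suc n) < v f" for n
  proof -
    obtain y where "y \<in> V" "Sup V - 1 / real (Suc n) < y"
      by (rule less_cSupE[OF _ ne, of "Sup V - 1 / real (Suc n)"]) simp_all
    then show ?thesis by (auto simp: V_def)
  qed
  then obtain F where F: "\<And>n. 1-lipschitz_on UNIV (F n)" "\<And>n. Sup V - 1 / real (Suc n) < v (F n)"
    by metis
  obtain k f where k: "strict_mono k" and lim: "\<And>x. (\<lambda>n. F (k n) x - F (k n) z) \<longlonglongrightarrow> f x"
    using lipschitz_convergent_subsequence[of 1 "\<lambda>n x. F n x - F n z" "dist z"] normalize[OF F(1)] by blast
  have f: "1-lipschitz_on UNIV f"
  proof (rule lipschitz_onI)
    fix x y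
    show "dist (f x) (f y) \<le> 1 * dist x y"
      by (rule tendsto_upperbound[OF tendsto_dist[OF lim lim]])
        (use lipschitz_onD[OF normalize(1)[OF F(1)]] in \<open>auto intro!: always_eventually\<close>)
  qed simp
  have conv: "(\<lambda>n. \<integral>x. F (k n) x - F (k n) z \<partial>\<rho>) \<longlonglongrightarrow> (\<integral>x. f x \<partial>\<rho>)" if "\<rho> \<in> {\<mu>, \<nu>}" for \<rho>
  proof (rule integral_dominated_convergence)
    show "integrable \<rho> (dist z)" using integrable_dist that \<mu> \<nu> by blast
    show "f \<in> borel_measurable \<rho>" "(\<lambda>x. F (k n) x - F (k n) z) \<in> borel_measurable \<rho>" for n
      using int[OF f] int[OF normalize(1)[OF F(1)]] that by auto
  qed (use lim normalize(3)[OF F(1)] in auto)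
  have "(\<lambda>n. v (\<lambda>x. F (k n) x - F (k n) z)) \<longlonglongrightarrow> v f"
    unfolding v_def by (intro tendsto_diff conv) auto
  then have lim_v: "(\<lambda>n. v (F (k n))) \<longlonglongrightarrow> v f" by (simp add: normalize(2)[OF F(1)])
  have "(\<lambda>n. Sup V - 1 / real (Suc (k n))) \<longlonglongrightarrow> Sup V - 0"
    by (intro tendsto_intros LIMSEQ_subseq_LIMSEQ[OF LIMSEQ_Suc[OF lim_const_over_n] k, unfolded comp_def])
  then have "Sup V - 0 \<le> v f"
    by (rule LIMSEQ_le[OF _ lim_v]) (intro exI allI impI less_imp_le F(2))
  then have le: "W1 \<mu> \<nu> \<le> ennreal (v f)"
    by (intro W1_le_if_dual_le[OF \<mu> \<nu>]) (use upper in \<open>auto simp: v_def intro: order_trans\<close>)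
  have "ennreal \<bar>v f\<bar> \<le> ennreal 1 * W1 \<mu> \<nu>"
    unfolding v_def
    by (rule integral_diff_le_W1[OF prob_measures1_sub[OF \<mu>] prob_measures1_sub[OF \<nu>] int[OF f], of UNIV])
      (use lipschitz_onD[OF f] in \<open>auto simp: dist_real_def\<close>)
  then have "ennreal (v f) \<le> W1 \<mu> \<nu>"
    using order_trans[OF ennreal_leI[OF abs_ge_self[of "v f"]]] by simp
  with le have "W1 \<mu> \<nu> = ennreal (v f)" by (rule antisym)
  with f show ?thesis unfolding v_def by (rule that)
qed

section \<open>Supports and Lipschitz norms\<close>

text \<open>\<open>measure_of\<close> takes over the given set function once countable additivity is
  proved. On a non-measurable set both sides are 0.\<close>

lemma emeasure_measure_add:
  assumes "sets \<mu> = sets \<nu>"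
  shows "emeasure (measure_add \<mu> \<nu>) A = emeasure \<mu> A + emeasure \<nu> A"
proof (cases "A \<in> sets \<mu>")
  case True
  have sets_eq: "sets (measure_add \<mu> \<nu>) = sets \<mu>" by (simp add: measure_add_def)
  show ?thesis
  proof (rule emeasure_measure_of[OF measure_add_def])
    show "countably_additive (sets (measure_add \<mu> \<nu>)) (\<lambda>A. emeasure \<mu> A + emeasure \<nu> A)"
    proof (rule countably_additiveI)
      fix X :: "nat \<Rightarrow> _" assume X: "range X \<subseteq> sets (measure_add \<mu> \<nu>)" "disjoint_family X"
      then have "range X \<subseteq> sets \<mu>" "range X \<subseteq> sets \<nu>" 
        by (simp_all add: sets_eq assms)
      then show "(\<Sum>i. emeasure \<mu> (X i) + emeasure \<nu> (X i)) = emeasure \<mu> (\<Union>i. X i) + emeasure \<nu> (\<Union>i. X i)"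
        using X(2) by (simp add: suminf_add[symmetric] suminf_emeasure)
    qed
  qed (use True sets.space_closed in \<open>auto simp: positive_def measure_add_def\<close>)
next
  case False
  moreover have "sets (measure_add \<mu> \<nu>) = sets \<mu>" by (simp add: measure_add_def)
  ultimately show ?thesis using assms by (simp add: emeasure_notin_sets)
qed

lemma closed_msupp: "closed (msupp \<mu>)"
proof -
  have "- msupp \<mu> = \<Union>{U. open U \<and> emeasure \<mu> U = 0}"
    by (auto simp: msupp_def zero_less_iff_neq_zero)
  then show ?thesis by (auto simp: closed_def)
qed

text \<open>The complement of the support is a union of possibly uncountably many open null sets; a
  countable basis reduces it to a countable union.\<close>

lemma AE_in_msupp:
  fixes \<mu> :: "'a::second_countable_topology measure"
  assumes "sets \<mu> = sets borel"
  shows "AE x in \<mu>. x \<in> msupp \<mu>"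
proof -
  obtain \<B> :: "'a set set" where \<B>: "countable \<B>" "topological_basis \<B>"
    using ex_countable_basis by blast
  show ?thesis
  proof (rule AE_I')
    show "\<Union>{U\<in>\<B>. emeasure \<mu> U = 0} \<in> null_sets \<mu>"
      using \<B> topological_basis_open[OF \<B>(2)]
      by (intro null_sets_UN'[where N="\<lambda>U. U" and I="{U\<in>\<B>. emeasure \<mu> U = 0}", simplified])
        (auto intro!: null_setsI simp: assms)
    show "{x \<in> space \<mu>. x \<notin> msupp \<mu>} \<subseteq> \<Union>{U\<in>\<B>. emeasure \<mu> U = 0}"
    proof safe
      fix x assume "x \<notin> msupp \<mu>"
      then obtain U where U: "open U" "x \<in> U" "emeasure \<mu> U = 0" by (auto simp: msupp_def zero_less_iff_neq_zero)
      obtain U' where U': "U' \<in> \<B>" "x \<in> U'" "U' \<subseteq> U" using topological_basisE[OF \<B>(2) U(1,2)] by blast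
      have "emeasure \<mu> U' \<le> emeasure \<mu> U" using U(1) U'(3) by (intro emeasure_mono) (auto simp: assms)
      then show "x \<in> \<Union>{U\<in>\<B>. emeasure \<mu> U = 0}" using U' U(3) by auto
    qed
  qed
qed

lemma AE_in_msupp_measure_add:
  fixes \<mu> \<nu> :: "'a::second_countable_topology measure"
  assumes "sets \<mu> = sets borel" "sets \<nu> = sets borel"
  shows "AE x in \<mu>. x \<in> msupp (measure_add \<mu> \<nu>)" "AE x in \<nu>. x \<in> msupp (measure_add \<mu> \<nu>)"
proof -
  have "msupp \<mu> \<subseteq> msupp (measure_add \<mu> \<nu>)" "msupp \<nu> \<subseteq> msupp (measure_add \<mu> \<nu>)"
    using assms by (auto simp: msupp_def emeasure_measure_add add_pos_nonneg add_nonneg_pos)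
  then show "AE x in \<mu>. x \<in> msupp (measure_add \<mu> \<nu>)" "AE x in \<nu>. x \<in> msupp (measure_add \<mu> \<nu>)"
    using AE_in_msupp[OF assms(1)] AE_in_msupp[OF assms(2)] by (auto elim!: eventually_mono)
qed

text \<open>Translates the extended seminorm into \<open>lipschitz_on\<close>, from which continuity
  and measurability are derived.\<close>

lemma lip_norm_le_iff:
  assumes "0 \<le> K"
  shows "lip_norm M f \<le> ennreal K \<longleftrightarrow> K-lipschitz_on M f"
proof
  assume le: "lip_norm M f \<le> ennreal K"
  show "K-lipschitz_on M f"
  proof (rule lipschitz_onI)
    fix x y assume xy: "x \<in> M" "y \<in> M"
    show "dist (f x) (f y) \<le> K * dist x y"
    proof (cases "x = y")
      case False
      then have "ennreal (\<bar>f x - f y\<bar> / dist x y) \<le> lip_norm M f"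
        unfolding lip_norm_def using xy by (intro SUP_upper2[of "(x, y)"]) auto
      also note le
      finally show ?thesis using False assms by (simp add: dist_real_def field_simps)
    qed simp
  qed (fact assms)
next
  assume "K-lipschitz_on M f"
  then show "lip_norm M f \<le> ennreal K"
    unfolding lip_norm_def lipschitz_on_def
    by (intro SUP_least) (auto intro!: ennreal_leI simp: dist_real_def field_simps)
qed

text \<open>An essential supremum is an upper bound almost everywhere. For the potential \<Phi> this
  gives \<open>exp (- \<Phi> x) \<le> 1\<close> almost everywhere.\<close>

lemma AE_nonneg_if_ess_inf_eq_0:
  assumes "ess_inf \<mu> f = 0"
  shows "AE x in \<mu>. 0 \<le> f x"
proof -
  have "esssup \<mu> (\<lambda>x. - ereal (f x)) = 0"
    using assms by (simp add: ess_inf_def ereal_uminus_eq_reorder)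
  then show ?thesis using esssup_AE[of "\<lambda>x. - ereal (f x)" \<mu>] by (simp add: zero_ereal_def)
qed

section \<open>Gibbs measures\<close>

text \<open>A change of density. Measurability is asked of the product with the indicator because a
  potential is controlled on \<open>S\<close> only and arbitrary elsewhere.\<close>

lemma set_integral_gibbs:
  assumes \<mu>: "sets \<mu> = sets borel" and \<Phi>: "\<Phi> \<in> borel_measurable borel"
    and Z: "0 < normalizer \<Phi> \<mu>" "normalizer \<Phi> \<mu> < \<infinity>"
    and f: "(\<lambda>x. indicator S x * f x) \<in> borel_measurable borel"
  shows "(LINT x:S|gibbs \<Phi> \<mu>. f x)
    = (\<integral>x. indicator S x * f x * exp (- \<Phi> x) \<partial>\<mu>) / enn2real (normalizer \<Phi> \<mu>)"
proof -
  note [measurable_cong] = \<mu> and [measurable] = \<Phi> f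
  define z where "z = enn2real (normalizer \<Phi> \<mu>)"
  have z: "0 < z" "normalizer \<Phi> \<mu> = ennreal z"
    using Z by (auto simp: z_def enn2real_positive_iff less_top)
  have "gibbs \<Phi> \<mu> = density \<mu> (\<lambda>x. ennreal (exp (- \<Phi> x) / z))"
    unfolding gibbs_def z(2) by (simp add: divide_ennreal z(1))
  then have "(LINT x:S|gibbs \<Phi> \<mu>. f x) = (\<integral>x. (exp (- \<Phi> x) / z) *\<^sub>R (indicator S x * f x) \<partial>\<mu>)"
    unfolding set_lebesgue_integral_def using z(1)
    by (simp, subst integral_density) (auto simp: real_scaleR_def)
  also have "\<dots> = (\<integral>x. indicator S x * f x * exp (- \<Phi> x) / z \<partial>\<mu>)"
    by (intro Bochner_Integration.integral_cong) auto
  finally show ?thesis by (simp add: z_def)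
qed

lemma normalizer_eq_integral:
  assumes \<mu>: "sets \<mu> = sets borel" and \<Phi>: "\<Phi> \<in> borel_measurable borel"
    and Z: "normalizer \<Phi> \<mu> < \<infinity>"
  shows "integrable \<mu> (\<lambda>x. exp (- \<Phi> x))" "(\<integral>x. exp (- \<Phi> x) \<partial>\<mu>) = enn2real (normalizer \<Phi> \<mu>)"
proof -
  note [measurable_cong] = \<mu> and [measurable] = \<Phi>
  show "integrable \<mu> (\<lambda>x. exp (- \<Phi> x))"
    by (rule integrableI_nonneg) (use Z in \<open>auto simp: normalizer_def\<close>)
  show "(\<integral>x. exp (- \<Phi> x) \<partial>\<mu>) = enn2real (normalizer \<Phi> \<mu>)"
    unfolding normalizer_def by (rule integral_eq_nn_integral) auto
qed

text \<open>Subtracting and adding \<open>a2 / z1\<close> leaves \<open>z1\<close> as the only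
  denominator besides the ratio \<open>a2 / z2\<close>, which \<open>r\<close> bounds. Exchanging
  the roles of the indices gives \<open>z2\<close> instead, so the larger one may be chosen.\<close>

lemma normalized_difference_bound:
  fixes a1 a2 z1 z2 r K :: real
  assumes "0 < z1" "0 < z2" "\<bar>a1\<bar> \<le> r * z1" "\<bar>a2\<bar> \<le> r * z2" "\<bar>a1 - a2\<bar> \<le> K"
  shows "\<bar>a1 / z1 - a2 / z2\<bar> \<le> K / max z1 z2 + \<bar>z1 - z2\<bar> / max z1 z2 * r"
proof -
  have *: "\<bar>a1 / z1 - a2 / z2\<bar> \<le> K / z1 + \<bar>z1 - z2\<bar> / z1 * r"
    if "0 < z1" "0 < z2" "\<bar>a2\<bar> \<le> r * z2" "\<bar>a1 - a2\<bar> \<le> K" for a1 a2 z1 z2 :: real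
  proof -
    have "a1 / z1 - a2 / z2 = (a1 - a2) / z1 - (z1 - z2) / z1 * (a2 / z2)"
      using that(1,2) by (simp add: field_simps)
    also have "\<bar>\<dots>\<bar> \<le> \<bar>(a1 - a2) / z1\<bar> + \<bar>(z1 - z2) / z1 * (a2 / z2)\<bar>"
      by (rule abs_triangle_ineq4)
    also have "\<dots> = \<bar>a1 - a2\<bar> / z1 + \<bar>z1 - z2\<bar> / z1 * (\<bar>a2\<bar> / z2)"
      using that(1,2) by (simp add: abs_mult)
    also have "\<dots> \<le> K / z1 + \<bar>z1 - z2\<bar> / z1 * r"
      using that by (intro add_mono divide_right_mono mult_left_mono) (auto simp: field_simps)
    finally show ?thesis .
  qed
  show ?thesis
    using *[of z1 z2 a2 a1] *[of z2 z1 a1 a2] assms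
    by (cases "z1 \<ge> z2") (auto simp: max_def abs_minus_commute)
qed

lemma lipschitz_on_indicator_measurable:
  fixes f :: "'a::metric_space \<Rightarrow> real"
  assumes "C-lipschitz_on S f" "closed S"
  shows "(\<lambda>x. indicator S x * f x) \<in> borel_measurable borel"
  using borel_measurable_continuous_on_indicator[OF borel_closed[OF assms(2)] lipschitz_on_continuous_on[OF assms(1)]]
  by simp

section \<open>Stability of Gibbs measures under a change of the reference measure\<close>

theorem proposition6p4:
  fixes \<mu>\<^sub>1 \<mu>\<^sub>2 :: "'a::polish_space measure" and \<Phi> :: "'a \<Rightarrow> real"
  defines "S \<equiv> msupp (measure_add \<mu>\<^sub>1 \<mu>\<^sub>2)"
    and "R \<equiv> supp_diam (measure_add \<mu>\<^sub>1 \<mu>\<^sub>2)"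
    and "Z\<^sub>1 \<equiv> normalizer \<Phi> \<mu>\<^sub>1"
    and "Z\<^sub>2 \<equiv> normalizer \<Phi> \<mu>\<^sub>2"
    and "\<nu>\<^sub>1 \<equiv> gibbs \<Phi> \<mu>\<^sub>1"
    and "\<nu>\<^sub>2 \<equiv> gibbs \<Phi> \<mu>\<^sub>2"
  defines "L \<equiv> lip_norm S (\<lambda>x. exp (- \<Phi> x))"
    and "\<Delta> \<equiv> ennreal \<bar>enn2real Z\<^sub>1 - enn2real Z\<^sub>2\<bar>"
  assumes "\<mu>\<^sub>1 \<in> prob_measures1" and "\<mu>\<^sub>2 \<in> prob_measures1"
    and "\<Phi> \<in> borel_measurable borel"
    and "L < \<infinity>"
    and "0 < Z\<^sub>1" and "Z\<^sub>1 < \<infinity>" and "\<nu>\<^sub>1 \<in> prob_measures1"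
    and "0 < Z\<^sub>2" and "Z\<^sub>2 < \<infinity>" and "\<nu>\<^sub>2 \<in> prob_measures1"
  shows
    "(\<Delta> \<le> L * W1 \<mu>\<^sub>1 \<mu>\<^sub>2 \<and> (\<exists>f. optimal_potential S \<nu>\<^sub>1 \<nu>\<^sub>2 f)) \<and>
     (\<forall>f. optimal_potential S \<nu>\<^sub>1 \<nu>\<^sub>2 f \<longrightarrow> lip_norm S (\<lambda>x. f x * exp (- \<Phi> x)) = 0 \<longrightarrow>
        (\<exists>c::real.
           (\<forall>x\<in>S. f x = c * exp (\<Phi> x)) \<and>
           W1 \<nu>\<^sub>1 \<nu>\<^sub>2 = ennreal \<bar>c\<bar> * (\<Delta> / (Z\<^sub>1 * Z\<^sub>2)) \<and>
           ennreal \<bar>c\<bar> * (\<Delta> / (Z\<^sub>1 * Z\<^sub>2)) \<le> ennreal \<bar>c\<bar> * (L / (Z\<^sub>1 * Z\<^sub>2)) * W1 \<mu>\<^sub>1 \<mu>\<^sub>2)) \<and>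
     (\<forall>f. optimal_potential S \<nu>\<^sub>1 \<nu>\<^sub>2 f \<longrightarrow>
        0 < lip_norm S (\<lambda>x. f x * exp (- \<Phi> x)) \<longrightarrow> lip_norm S (\<lambda>x. f x * exp (- \<Phi> x)) < \<infinity> \<longrightarrow>
        ess_inf \<mu>\<^sub>1 \<Phi> = 0 \<longrightarrow> ess_inf \<mu>\<^sub>2 \<Phi> = 0 \<longrightarrow> R < \<infinity> \<longrightarrow>
        W1 \<nu>\<^sub>1 \<nu>\<^sub>2 \<le> (1 + L * R) / max Z\<^sub>1 Z\<^sub>2 * W1 \<mu>\<^sub>1 \<mu>\<^sub>2 + \<Delta> / max Z\<^sub>1 Z\<^sub>2 * R \<and>
        (1 + L * R) / max Z\<^sub>1 Z\<^sub>2 * W1 \<mu>\<^sub>1 \<mu>\<^sub>2 + \<Delta> / max Z\<^sub>1 Z\<^sub>2 * R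
          \<le> (1 + 2 * L * R) * (W1 \<mu>\<^sub>1 \<mu>\<^sub>2 / max Z\<^sub>1 Z\<^sub>2))"
proof -
  note \<mu>1 = assms(9) and \<mu>2 = assms(10) and \<Phi>[measurable] = assms(11)
    and \<nu>1 = \<open>\<nu>\<^sub>1 \<in> prob_measures1\<close> and \<nu>2 = \<open>\<nu>\<^sub>2 \<in> prob_measures1\<close>
  note \<mu>1' = prob_measures1_sub[OF \<mu>1] and \<mu>2' = prob_measures1_sub[OF \<mu>2]
  note sets = prob_measuresD(2)[OF \<mu>1'] prob_measuresD(2)[OF \<mu>2']
  note [measurable_cong] = sets
  interpret M1: prob_space \<mu>\<^sub>1 by (rule prob_measuresD(1)[OF \<mu>1'])
  interpret M2: prob_space \<mu>\<^sub>2 by (rule prob_measuresD(1)[OF \<mu>2'])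
  \<comment> \<open>All extended quantities involved are finite; they are written as images of reals
    so that the estimates become real arithmetic.\<close>
  define z1 where "z1 = enn2real Z\<^sub>1"
  define z2 where "z2 = enn2real Z\<^sub>2"
  define l where "l = enn2real L"
  define w where "w = enn2real (W1 \<mu>\<^sub>1 \<mu>\<^sub>2)"
  define g where "g = (\<lambda>x. exp (- \<Phi> x))"
  have g_meas[measurable]: "g \<in> borel_measurable borel" unfolding g_def by measurable
  have z1: "0 < z1" "Z\<^sub>1 = ennreal z1" and z2: "0 < z2" "Z\<^sub>2 = ennreal z2"
    using assms(13-18) by (auto simp: z1_def z2_def enn2real_positive_iff less_top)
  have l: "0 \<le> l" "L = ennreal l" using assms(12) by (auto simp: l_def less_top)
  \<comment> \<open>Finiteness of the distance comes from duality, which exhibits it as the image of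
    a real number.\<close>
  have w: "0 \<le> w" "W1 \<mu>\<^sub>1 \<mu>\<^sub>2 = ennreal w"
    by (rule kantorovich_rubinstein[OF \<mu>1 \<mu>2], simp add: w_def)+
  have \<Delta>: "\<Delta> = ennreal \<bar>z1 - z2\<bar>" by (simp add: \<Delta>_def z1_def z2_def)
  have S_closed: "closed S" unfolding S_def by (rule closed_msupp)
  have S_borel[measurable]: "S \<in> sets borel" using S_closed by (rule borel_closed)
  have AE_S: "AE x in \<mu>\<^sub>1. x \<in> S" "AE x in \<mu>\<^sub>2. x \<in> S"
    unfolding S_def using AE_in_msupp_measure_add[OF sets] by auto
  have g_int: "integrable \<mu>\<^sub>1 g" "integrable \<mu>\<^sub>2 g" "(\<integral>x. g x \<partial>\<mu>\<^sub>1) = z1" "(\<integral>x. g x \<partial>\<mu>\<^sub>2) = z2"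
    using normalizer_eq_integral[OF sets(1) \<Phi>] normalizer_eq_integral[OF sets(2) \<Phi>] assms(14,17)
    by (simp_all add: g_def z1_def z2_def Z\<^sub>1_def Z\<^sub>2_def)
  have g_lip: "l-lipschitz_on S g"
    using lip_norm_le_iff[OF l(1), of S g] l(2) by (simp add: L_def g_def)
  \<comment> \<open>The normalizers are the integrals of \<open>g\<close>, so the easy half of
    duality applies to \<open>g\<close> itself.\<close>
  have \<Delta>_le: "\<Delta> \<le> L * W1 \<mu>\<^sub>1 \<mu>\<^sub>2"
    using integral_diff_le_W1[OF \<mu>1' \<mu>2' g_int(1,2) AE_S _ l(1)] lipschitz_onD[OF g_lip]
    by (simp add: g_int(3,4) \<Delta> l(2) dist_real_def)
  have \<nu>_AE: "AE x in \<nu>\<^sub>1. x \<in> S" "AE x in \<nu>\<^sub>2. x \<in> S"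
    using AE_S unfolding \<nu>\<^sub>1_def \<nu>\<^sub>2_def gibbs_def normalizer_def by (auto simp: AE_density)
  have gibbs_int: "(LINT x:S|\<nu>\<^sub>1. f x) = (\<integral>x. indicator S x * f x * g x \<partial>\<mu>\<^sub>1) / z1"
    "(LINT x:S|\<nu>\<^sub>2. f x) = (\<integral>x. indicator S x * f x * g x \<partial>\<mu>\<^sub>2) / z2"
    if "1-lipschitz_on S f" for f
    using set_integral_gibbs[OF sets(1) \<Phi> _ _ lipschitz_on_indicator_measurable[OF that S_closed]]
      set_integral_gibbs[OF sets(2) \<Phi> _ _ lipschitz_on_indicator_measurable[OF that S_closed]] assms(13-18)
    by (simp_all add: g_def z1_def z2_def Z\<^sub>1_def Z\<^sub>2_def \<nu>\<^sub>1_def \<nu>\<^sub>2_def)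
  have existence: "\<exists>f. optimal_potential S \<nu>\<^sub>1 \<nu>\<^sub>2 f"
  proof -
    note \<nu>1' = prob_measures1_sub[OF \<nu>1] and \<nu>2' = prob_measures1_sub[OF \<nu>2]
    note [measurable_cong] = prob_measuresD(2)[OF \<nu>1'] prob_measuresD(2)[OF \<nu>2']
    obtain f where f: "1-lipschitz_on UNIV f" "W1 \<nu>\<^sub>1 \<nu>\<^sub>2 = ennreal ((\<integral>x. f x \<partial>\<nu>\<^sub>1) - (\<integral>x. f x \<partial>\<nu>\<^sub>2))"
      by (rule kantorovich_rubinstein[OF \<nu>1 \<nu>2])
    have [measurable]: "f \<in> borel_measurable borel"
      by (rule borel_measurable_continuous_onI[OF lipschitz_on_continuous_on[OF f(1)]])
    have set_int: "(LINT x:S|\<rho>. f x) = (\<integral>x. f x \<partial>\<rho>)"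
      if [measurable_cong]: "sets \<rho> = sets borel" and "AE x in \<rho>. x \<in> S" for \<rho>
      unfolding set_lebesgue_integral_def
      by (rule integral_cong_AE) (use that(2) in \<open>auto elim!: eventually_mono\<close>)
    have "(LINT x:S|\<nu>\<^sub>1. f x) = (\<integral>x. f x \<partial>\<nu>\<^sub>1)" "(LINT x:S|\<nu>\<^sub>2. f x) = (\<integral>x. f x \<partial>\<nu>\<^sub>2)"
      using set_int prob_measuresD(2)[OF \<nu>1'] prob_measuresD(2)[OF \<nu>2'] \<nu>_AE by auto
    \<comment> \<open>\<open>ennreal\<close> sends negative reals to 0, so the duality formula alone
      does not give the absolute value; the easy half of duality supplies the missing
      inequality.\<close>
    moreover
    have "ennreal \<bar>(\<integral>x. f x \<partial>\<nu>\<^sub>1) - (\<integral>x. f x \<partial>\<nu>\<^sub>2)\<bar> \<le> ennreal 1 * W1 \<nu>\<^sub>1 \<nu>\<^sub>2"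
      by (rule integral_diff_le_W1[OF \<nu>1' \<nu>2' integrable_lipschitz[OF \<nu>1 f(1)] integrable_lipschitz[OF \<nu>2 f(1)], of UNIV])
        (use lipschitz_onD[OF f(1)] in \<open>auto simp: dist_real_def\<close>)
    then have "W1 \<nu>\<^sub>1 \<nu>\<^sub>2 = ennreal \<bar>(\<integral>x. f x \<partial>\<nu>\<^sub>1) - (\<integral>x. f x \<partial>\<nu>\<^sub>2)\<bar>"
      using f(2) by (intro antisym) (auto intro: ennreal_leI)
    moreover have "lip_norm S f \<le> 1"
      using lip_norm_le_iff[of 1 S f] lipschitz_on_subset[OF f(1)] by simp
    ultimately show ?thesis unfolding optimal_potential_def by auto
  qed
  have opt: "1-lipschitz_on S f" "W1 \<nu>\<^sub>1 \<nu>\<^sub>2 = ennreal \<bar>(\<integral>x. indicator S x * f x * g x \<partial>\<mu>\<^sub>1) / z1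
      - (\<integral>x. indicator S x * f x * g x \<partial>\<mu>\<^sub>2) / z2\<bar>" if "optimal_potential S \<nu>\<^sub>1 \<nu>\<^sub>2 f" for f
  proof -
    show "1-lipschitz_on S f" using that lip_norm_le_iff[of 1 S f] by (simp add: optimal_potential_def)
    from gibbs_int[OF this] that show "W1 \<nu>\<^sub>1 \<nu>\<^sub>2 = ennreal \<bar>(\<integral>x. indicator S x * f x * g x \<partial>\<mu>\<^sub>1) / z1
      - (\<integral>x. indicator S x * f x * g x \<partial>\<mu>\<^sub>2) / z2\<bar>" by (simp add: optimal_potential_def)
  qed
  have measure_S: "measure \<mu>\<^sub>1 S = 1" "measure \<mu>\<^sub>2 S = 1"
    using M1.prob_eq_1[of S] M2.prob_eq_1[of S] AE_S by (simp_all add: sets)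
  have "S \<noteq> {}" using measure_S by auto
  then obtain s where s: "s \<in> S" by blast
  have part_ii: "\<exists>c. (\<forall>x\<in>S. f x = c * exp (\<Phi> x)) \<and>
           W1 \<nu>\<^sub>1 \<nu>\<^sub>2 = ennreal \<bar>c\<bar> * (\<Delta> / (Z\<^sub>1 * Z\<^sub>2)) \<and>
           ennreal \<bar>c\<bar> * (\<Delta> / (Z\<^sub>1 * Z\<^sub>2)) \<le> ennreal \<bar>c\<bar> * (L / (Z\<^sub>1 * Z\<^sub>2)) * W1 \<mu>\<^sub>1 \<mu>\<^sub>2"
    if f: "optimal_potential S \<nu>\<^sub>1 \<nu>\<^sub>2 f" and 0: "lip_norm S (\<lambda>x. f x * exp (- \<Phi> x)) = 0" for f
  proof (intro exI conjI ballI)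
    \<comment> \<open>A function with Lipschitz seminorm 0 is constant on \<open>S\<close>; its
      value at the base point \<open>s\<close> serves as \<lambda>.\<close>
    define c where "c = f s * g s"
    have c: "f x * g x = c" if "x \<in> S" for x
      using lip_norm_le_iff[of 0 S "\<lambda>x. f x * g x"] 0 lipschitz_onD[OF _ that s, of 0 "\<lambda>x. f x * g x"]
      by (simp add: g_def c_def)
    show "f x = c * exp (\<Phi> x)" if "x \<in> S" for x
      using c[OF that] by (auto simp: g_def exp_minus field_simps)
    have eq: "(\<lambda>x. indicator S x * f x * g x) = (\<lambda>x. c * indicator S x)"
      using c by (auto simp: indicator_def)
    have "W1 \<nu>\<^sub>1 \<nu>\<^sub>2 = ennreal \<bar>c / z1 - c / z2\<bar>"
      using opt(2)[OF f] measure_S unfolding eq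
      by (simp add: prob_measuresD(3)[OF \<mu>1'] prob_measuresD(3)[OF \<mu>2'])
    also have "c / z1 - c / z2 = c * ((z2 - z1) / (z1 * z2))" using z1 z2 by (simp add: field_simps)
    also have "ennreal \<bar>\<dots>\<bar> = ennreal \<bar>c\<bar> * (\<Delta> / (Z\<^sub>1 * Z\<^sub>2))"
      using z1 z2 by (simp add: \<Delta> abs_mult ennreal_mult[symmetric] divide_ennreal abs_minus_commute)
    finally show "W1 \<nu>\<^sub>1 \<nu>\<^sub>2 = ennreal \<bar>c\<bar> * (\<Delta> / (Z\<^sub>1 * Z\<^sub>2))" .
    have "\<Delta> / (Z\<^sub>1 * Z\<^sub>2) \<le> L * W1 \<mu>\<^sub>1 \<mu>\<^sub>2 / (Z\<^sub>1 * Z\<^sub>2)"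
      by (rule divide_right_mono_ennreal[OF \<Delta>_le])
    then have "ennreal \<bar>c\<bar> * (\<Delta> / (Z\<^sub>1 * Z\<^sub>2)) \<le> ennreal \<bar>c\<bar> * (L * W1 \<mu>\<^sub>1 \<mu>\<^sub>2 / (Z\<^sub>1 * Z\<^sub>2))"
      by (rule mult_left_mono) simp
    then show "ennreal \<bar>c\<bar> * (\<Delta> / (Z\<^sub>1 * Z\<^sub>2)) \<le> ennreal \<bar>c\<bar> * (L / (Z\<^sub>1 * Z\<^sub>2)) * W1 \<mu>\<^sub>1 \<mu>\<^sub>2"
      by (simp add: divide_ennreal_def mult_ac)
  qed
  have part_iii: "W1 \<nu>\<^sub>1 \<nu>\<^sub>2 \<le> (1 + L * R) / max Z\<^sub>1 Z\<^sub>2 * W1 \<mu>\<^sub>1 \<mu>\<^sub>2 + \<Delta> / max Z\<^sub>1 Z\<^sub>2 * R \<and>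
        (1 + L * R) / max Z\<^sub>1 Z\<^sub>2 * W1 \<mu>\<^sub>1 \<mu>\<^sub>2 + \<Delta> / max Z\<^sub>1 Z\<^sub>2 * R
          \<le> (1 + 2 * L * R) * (W1 \<mu>\<^sub>1 \<mu>\<^sub>2 / max Z\<^sub>1 Z\<^sub>2)"
    if f: "optimal_potential S \<nu>\<^sub>1 \<nu>\<^sub>2 f" and ess: "ess_inf \<mu>\<^sub>1 \<Phi> = 0" "ess_inf \<mu>\<^sub>2 \<Phi> = 0" and "R < \<infinity>" for f
  proof -
    define r where "r = enn2real R"
    have r: "0 \<le> r" "R = ennreal r" using \<open>R < \<infinity>\<close> by (auto simp: r_def less_top)
    have dist_le: "dist x y \<le> r" if "x \<in> S" "y \<in> S" for x y
    proof -
      have "ennreal (dist x y) \<le> R"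
        unfolding R_def supp_diam_def S_def[symmetric]
        by (rule SUP_upper2[OF that(1) SUP_upper2[OF that(2) order_refl]])
      then show ?thesis using r by simp
    qed
    define m where "m = max z1 z2"
    have m: "0 < m" "max Z\<^sub>1 Z\<^sub>2 = ennreal m"
      using z1 z2 by (auto simp: m_def max_def)
    \<comment> \<open>The essential infimum bounds \<open>g\<close> by 1 almost everywhere, so this
      subset still has full measure for both measures.\<close>
    define S' where "S' = {x\<in>S. g x \<le> 1}"
    have AE_S': "AE x in \<mu>\<^sub>1. x \<in> S'" "AE x in \<mu>\<^sub>2. x \<in> S'"
      using AE_S AE_nonneg_if_ess_inf_eq_0[OF ess(1)] AE_nonneg_if_ess_inf_eq_0[OF ess(2)]
      by (auto simp: S'_def g_def elim: eventually_elim2)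
    \<comment> \<open>Recentring at \<open>s\<close> bounds the potential by the diameter. It
      changes both Gibbs integrals by the same constant \<open>f s\<close>, which cancels in their
      difference.\<close>
    define h where "h = (\<lambda>x. indicator S x * (f x - f s) * g x)"
    have f_lip: "\<bar>f x - f y\<bar> \<le> dist x y" if "x \<in> S" "y \<in> S" for x y
      using lipschitz_onD[OF opt(1)[OF f] that] by (simp add: dist_real_def)
    have f_le: "\<bar>f x - f s\<bar> \<le> r" if "x \<in> S" for x
      using f_lip[OF that s] dist_le[OF that s] by simp
    have h_bound: "\<bar>h x\<bar> \<le> r * g x" for x
      using f_le[of x] r(1) by (auto simp: h_def g_def abs_mult indicator_def)
    have f_meas[measurable]: "(\<lambda>x. indicator S x * f x) \<in> borel_measurable borel"
      by (rule lipschitz_on_indicator_measurable[OF opt(1)[OF f] S_closed])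
    have h_eq: "h x = indicator S x * f x * g x - f s * (indicator S x * g x)" for x
      by (simp add: h_def algebra_simps)
    have h_meas[measurable]: "h \<in> borel_measurable borel"
      unfolding h_eq[abs_def] by measurable
    have Sg: "integrable \<rho> (\<lambda>x. indicator S x * g x)" "(\<integral>x. indicator S x * g x \<partial>\<rho>) = (\<integral>x. g x \<partial>\<rho>)"
      and h_int: "integrable \<rho> h" and h_le: "\<bar>\<integral>x. h x \<partial>\<rho>\<bar> \<le> r * (\<integral>x. g x \<partial>\<rho>)"
      if \<rho>: "\<rho> \<in> {\<mu>\<^sub>1, \<mu>\<^sub>2}" for \<rho>
    proof -
      have [measurable_cong]: "sets \<rho> = sets borel" and g_int: "integrable \<rho> g" and AE_S: "AE x in \<rho>. x \<in> S"
        using \<rho> sets g_int AE_S by auto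
      show "integrable \<rho> (\<lambda>x. indicator S x * g x)"
        by (rule Bochner_Integration.integrable_bound[OF g_int]) (auto simp: indicator_def)
      show "(\<integral>x. indicator S x * g x \<partial>\<rho>) = (\<integral>x. g x \<partial>\<rho>)"
        by (rule integral_cong_AE) (use AE_S in \<open>auto elim!: eventually_mono\<close>)
      show h_int: "integrable \<rho> h"
        by (rule Bochner_Integration.integrable_bound[of _ "\<lambda>x. r * g x"])
          (use g_int h_bound r(1) in \<open>auto simp: g_def abs_mult intro: order_trans\<close>)
      have "\<bar>\<integral>x. h x \<partial>\<rho>\<bar> \<le> (\<integral>x. \<bar>h x\<bar> \<partial>\<rho>)" by (rule integral_abs_bound)
      also have "\<dots> \<le> (\<integral>x. r * g x \<partial>\<rho>)"
        by (rule integral_mono) (use h_int g_int h_bound in auto)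
      finally show "\<bar>\<integral>x. h x \<partial>\<rho>\<bar> \<le> r * (\<integral>x. g x \<partial>\<rho>)" by simp
    qed
    define a1 where "a1 = (\<integral>x. h x \<partial>\<mu>\<^sub>1)"
    define a2 where "a2 = (\<integral>x. h x \<partial>\<mu>\<^sub>2)"
    have recentre: "(\<integral>x. indicator S x * f x * g x \<partial>\<rho>) = (\<integral>x. h x \<partial>\<rho>) + f s * (\<integral>x. g x \<partial>\<rho>)"
      if \<rho>: "\<rho> \<in> {\<mu>\<^sub>1, \<mu>\<^sub>2}" for \<rho>
    proof -
      have "(\<integral>x. indicator S x * f x * g x \<partial>\<rho>) = (\<integral>x. h x + f s * (indicator S x * g x) \<partial>\<rho>)"
        by (simp add: h_eq)
      also have "\<dots> = (\<integral>x. h x \<partial>\<rho>) + f s * (\<integral>x. indicator S x * g x \<partial>\<rho>)"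
        using h_int[OF \<rho>] Sg(1)[OF \<rho>] by simp
      finally show ?thesis by (simp add: Sg(2)[OF \<rho>])
    qed
    have W\<nu>: "W1 \<nu>\<^sub>1 \<nu>\<^sub>2 = ennreal \<bar>a1 / z1 - a2 / z2\<bar>"
      using opt(2)[OF f] recentre[of \<mu>\<^sub>1] recentre[of \<mu>\<^sub>2] z1 z2
      by (simp add: g_int(3,4) a1_def a2_def add_divide_distrib)
    have h_lip: "\<bar>h x - h y\<bar> \<le> (1 + l * r) * dist x y" if "x \<in> S'" "y \<in> S'" for x y
    proof -
      have xy: "x \<in> S" "y \<in> S" "0 \<le> g x" "g x \<le> 1" using that by (auto simp: S'_def g_def)
      \<comment> \<open>In this splitting the increment of \<open>f\<close> meets
        \<open>g x\<close>, at most 1, and the increment of \<open>g\<close> meets the recentred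
        potential, at most \<open>r\<close>.\<close>
      have "h x - h y = (f x - f y) * g x + (f y - f s) * (g x - g y)"
        using xy by (simp add: h_def algebra_simps)
      also have "\<bar>\<dots>\<bar> \<le> \<bar>f x - f y\<bar> * g x + \<bar>f y - f s\<bar> * \<bar>g x - g y\<bar>"
        using xy(3) by (metis abs_mult abs_of_nonneg abs_triangle_ineq)
      also have "\<dots> \<le> dist x y * 1 + r * (l * dist x y)"
        using f_lip[OF xy(1,2)] xy(3,4) f_le[OF xy(2)] lipschitz_onD[OF g_lip xy(1,2)] r(1)
        by (intro add_mono mult_mono) (auto simp: dist_real_def)
      finally show ?thesis by (simp add: algebra_simps)
    qed
    have "ennreal \<bar>a1 - a2\<bar> \<le> ennreal (1 + l * r) * W1 \<mu>\<^sub>1 \<mu>\<^sub>2"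
      unfolding a1_def a2_def
      by (rule integral_diff_le_W1[OF \<mu>1' \<mu>2' h_int h_int AE_S' h_lip]) (use l r in auto)
    also have "\<dots> = ennreal ((1 + l * r) * w)"
      unfolding w(2) using l(1) r(1) w(1) by (intro ennreal_mult[symmetric]) auto
    finally have "\<bar>a1 - a2\<bar> \<le> (1 + l * r) * w"
      using l(1) r(1) w(1) by (subst (asm) ennreal_le_iff) auto
    then have main: "\<bar>a1 / z1 - a2 / z2\<bar> \<le> (1 + l * r) * w / m + \<bar>z1 - z2\<bar> / m * r"
      unfolding m_def using z1 z2 h_le[of \<mu>\<^sub>1] h_le[of \<mu>\<^sub>2]
      by (intro normalized_difference_bound) (simp_all add: a1_def a2_def g_int(3,4))
    \<comment> \<open>Bounding the difference of the normalizers contributes a second term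
      \<open>l * r\<close>, hence the factor 2 in the last estimate.\<close>
    have "\<bar>z1 - z2\<bar> \<le> l * w"
      using \<Delta>_le l w by (simp add: \<Delta> ennreal_mult[symmetric])
    then have "\<bar>z1 - z2\<bar> / m * r \<le> l * w / m * r"
      using m(1) r(1) by (intro mult_right_mono divide_right_mono) auto
    moreover have "(1 + 2 * l * r) * (w / m) = (1 + l * r) * w / m + l * w / m * r"
      using m(1) by (simp add: field_simps)
    ultimately have second: "(1 + l * r) * w / m + \<bar>z1 - z2\<bar> / m * r \<le> (1 + 2 * l * r) * (w / m)"
      by linarith
    have eq1: "(1 + L * R) / max Z\<^sub>1 Z\<^sub>2 * W1 \<mu>\<^sub>1 \<mu>\<^sub>2 + \<Delta> / max Z\<^sub>1 Z\<^sub>2 * R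
        = ennreal ((1 + l * r) * w / m + \<bar>z1 - z2\<bar> / m * r)"
      unfolding m(2) l(2) r(2) w(2) \<Delta> ennreal_1[symmetric]
      using m(1) l(1) r(1) w(1)
      by (simp add: ennreal_mult[symmetric] ennreal_plus[symmetric] divide_ennreal del: ennreal_1 ennreal_plus)
    have eq2: "(1 + 2 * L * R) * (W1 \<mu>\<^sub>1 \<mu>\<^sub>2 / max Z\<^sub>1 Z\<^sub>2) = ennreal ((1 + 2 * l * r) * (w / m))"
      unfolding m(2) l(2) r(2) w(2) ennreal_1[symmetric] ennreal_numeral[symmetric]
      using m(1) l(1) r(1) w(1)
      by (simp add: ennreal_mult[symmetric] ennreal_plus[symmetric] divide_ennreal del: ennreal_1 ennreal_plus ennreal_numeral)
    show ?thesis unfolding eq1 eq2 W\<nu> using main second by (auto intro: ennreal_leI)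
  qed
  show ?thesis
    by (intro conjI allI impI \<Delta>_le existence part_ii) (auto dest: part_iii)
qed

end
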